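(* Let $m\ge1$ be an integer, let $X,Y$ be Banach spaces such that $Y$ has cotype $q$, and let $v:X \to Y$ be an $(r,1)$-summing operator (with $1 \leq r \leq q$). For $1 \leq p_{1}, \dots,p_{m} \leq \infty$ with $\frac{1}{p_{1}} + \cdots + \frac{1}{p_{m}} < \frac{1}{r}$ define \[ \frac{1}{\lambda} = \frac{1}{r} - \Big(\frac{1}{p_{1}} + \cdots + \frac{1}{p_{m}} \Big) \qquad \text{ and } \qquad \frac{1}{\mu} = \frac{1}{m \lambda} + \frac{m-1}{mq} . \] Then there exists $C>0$ such that, for every continuous $m$-linear $T : \ell_{p_{1}} \times \cdots \times \ell_{p_{m}} \to X$ with coefficients $a_{i_{1}, \ldots , i_{m}}=T(e_{i_1},\dots,e_{i_m})$, we have: (i) If $\lambda \geq q$, then \[ \Big( \sum_{i_{1}, \ldots, i_{m}=1}^{\infty} \Vert v a_{i_{1}, \ldots , i_{m}} \Vert^{\lambda}\Big)^{1/\lambda} \leq C \Vert T \Vert . \] (ii) If $\lambda < q$, then \[ \Big( \sum_{i_{1}, \ldots, i_{m}=1}^{\infty} \Vert v a_{i_{1}, \ldots , i_{m}} \Vert^{\mu}\Big)^{1/\mu} \leq C \Vert T \Vert . \]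
   Context: All Banach spaces are complex; $1/\infty=0$; $e_i$ is the $i$-th canonical unit vector; operators are bounded and linear. The norm of a continuous $m$-linear mapping is $\Vert T \Vert = \sup \{ \Vert T(x_{1}, \ldots , x_{m}) \Vert : \|x_j\|<1,\ j=1,\ldots,m\}$. A Banach space $Y$ has cotype $q$ ($2\le q\le\infty$, usual modification for $q=\infty$) if there is $C>0$ such that for all finite choices $x_1,\dots,x_N\in Y$, \[ \Big( \sum_{k=1}^{N} \Vert x_{k} \Vert^{q} \Big)^{1/q} \leq C \Big( \int_{0}^{1} \Big\Vert \sum_{k=1}^{N} r_{k} (t) x_{k} \Big\Vert^{2} dt \Big)^{1/2}, \] where $r_k$ is the $k$-th Rademacher function. An operator $v:X\to Y$ is $(r,s)$-summing ($s\le r$) if there is $C>0$ such that for all finite choices $x_1,\dots,x_N\in X$, \[ \Big( \sum_{k=1}^{N} \Vert v x_{k} \Vert^{r} \Big)^{1/r} \leq C \sup_{x^{*} \in B_{X^{*}}} \Big( \sum_{k=1}^{N} \vert x^{*} (x_{k}) \vert^{s} \Big)^{1/s}. \] *)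

theory Defs
  imports "HOL-Analysis.Analysis"
begin

subsection \<open>Complex Banach spaces\<close>

class complex_normed_vector = real_normed_vector +
  fixes scaleC :: "complex \<Rightarrow> 'a \<Rightarrow> 'a" (infixr "*\<^sub>C" 75)
  assumes scaleR_scaleC: "scaleR r x = complex_of_real r *\<^sub>C x"
    and scaleC_add_right: "c *\<^sub>C (x + y) = c *\<^sub>C x + c *\<^sub>C y"
    and scaleC_add_left: "(c + d) *\<^sub>C x = c *\<^sub>C x + d *\<^sub>C x"
    and scaleC_scaleC: "c *\<^sub>C (d *\<^sub>C x) = (c * d) *\<^sub>C x"
    and norm_scaleC: "norm (c *\<^sub>C x) = cmod c * norm x"

class complex_banach = complex_normed_vector + complete_space

instantiation complex :: complex_banach
begin

definition scaleC_complex :: "complex \<Rightarrow> complex \<Rightarrow> complex"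
  where "scaleC_complex c z = c * z"

instance
  by standard (simp_all add: scaleC_complex_def scaleR_conv_of_real norm_mult algebra_simps)

end

definition bounded_clinear :: "('a::complex_normed_vector \<Rightarrow> 'b::complex_normed_vector) \<Rightarrow> bool"
  where "bounded_clinear f \<longleftrightarrow> bounded_linear f \<and> (\<forall>c x. f (c *\<^sub>C x) = c *\<^sub>C f x)"

definition dual_ball :: "('a::complex_normed_vector \<Rightarrow> complex) set"
  where "dual_ball = {f. bounded_clinear f \<and> onorm f \<le> 1}"


subsection \<open>Cotype and summing operators\<close>

definition rademacher :: "nat \<Rightarrow> real \<Rightarrow> real"
  where "rademacher k t = sgn (sin (2 ^ k * pi * t))"

(* For q = \<infinity> the left-hand side is max_k norm (x k). *)
definition has_cotype :: "'a::complex_banach itself \<Rightarrow> ereal \<Rightarrow> bool"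
  where "has_cotype _ q \<longleftrightarrow> 2 \<le> q \<and>
    (\<exists>C>0. \<forall>(N::nat) (x :: nat \<Rightarrow> 'a).
      let R = sqrt (integral {0..1} (\<lambda>t. (norm (\<Sum>k\<in>{1..N}. rademacher k t *\<^sub>R x k))\<^sup>2)) in
      if q = \<infinity> then (\<forall>k\<in>{1..N}. norm (x k) \<le> C * R)
      else (\<Sum>k\<in>{1..N}. norm (x k) powr real_of_ereal q) powr (1 / real_of_ereal q) \<le> C * R)"

(* The supremum is over a nonempty set that is bounded above, so SUP on the reals is the true one. *)
definition summing_operator ::
    "real \<Rightarrow> real \<Rightarrow> ('a::complex_banach \<Rightarrow> 'b::complex_banach) \<Rightarrow> bool"
  where "summing_operator r s v \<longleftrightarrow> s \<le> r \<and> bounded_clinear v \<and>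
    (\<exists>C>0. \<forall>(N::nat) (x :: nat \<Rightarrow> 'a).
      (\<Sum>k\<in>{1..N}. norm (v (x k)) powr r) powr (1 / r)
        \<le> C * (SUP f\<in>dual_ball. (\<Sum>k\<in>{1..N}. cmod (f (x k)) powr s) powr (1 / s)))"


subsection \<open>The sequence spaces\<close>

text \<open>For an exponent \<open>1 \<le> p \<le> \<infinity>\<close>; sequences are indexed from \<open>0\<close>.\<close>

definition lp_space :: "ereal \<Rightarrow> (nat \<Rightarrow> complex) set"
  where "lp_space p = (if p = \<infinity> then {x. bdd_above (range (\<lambda>i. cmod (x i)))}
                       else {x. summable (\<lambda>i. cmod (x i) powr real_of_ereal p)})"

definition lp_norm :: "ereal \<Rightarrow> (nat \<Rightarrow> complex) \<Rightarrow> real"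
  where "lp_norm p x = (if p = \<infinity> then (SUP i. cmod (x i))
                        else (\<Sum>i. cmod (x i) powr real_of_ereal p) powr (1 / real_of_ereal p))"

definition unit_vec :: "nat \<Rightarrow> nat \<Rightarrow> complex"
  where "unit_vec n = (\<lambda>k. if k = n then 1 else 0)"


subsection \<open>Multilinear mappings\<close>

text \<open>The product of the spaces with exponents \<open>p 0, \<dots>, p (m - 1)\<close> is the extensional function
  space below; a mapping on it is only constrained on this set.\<close>

definition lp_prod :: "nat \<Rightarrow> (nat \<Rightarrow> ereal) \<Rightarrow> (nat \<Rightarrow> nat \<Rightarrow> complex) set"
  where "lp_prod m p = PiE {..<m} (\<lambda>j. lp_space (p j))"

definition multilinear_map ::
    "nat \<Rightarrow> (nat \<Rightarrow> ereal) \<Rightarrow> ((nat \<Rightarrow> nat \<Rightarrow> complex) \<Rightarrow> 'a::complex_banach) \<Rightarrow> bool"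
  where "multilinear_map m p T \<longleftrightarrow>
    (\<forall>x\<in>lp_prod m p. \<forall>j<m.
      (\<forall>y\<in>lp_space (p j). \<forall>z\<in>lp_space (p j).
        T (x(j := (\<lambda>n. y n + z n))) = T (x(j := y)) + T (x(j := z))) \<and>
      (\<forall>c. \<forall>y\<in>lp_space (p j). T (x(j := (\<lambda>n. c * y n))) = c *\<^sub>C T (x(j := y))))"

text \<open>Continuity for the product of the norm topologies, at every point of the product.\<close>

definition continuous_map_lp ::
    "nat \<Rightarrow> (nat \<Rightarrow> ereal) \<Rightarrow> ((nat \<Rightarrow> nat \<Rightarrow> complex) \<Rightarrow> 'a::complex_banach) \<Rightarrow> bool"
  where "continuous_map_lp m p T \<longleftrightarrow>
    (\<forall>x\<in>lp_prod m p. \<forall>\<epsilon>>0. \<exists>\<delta>>0. \<forall>y\<in>lp_prod m p.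
      (\<forall>j<m. lp_norm (p j) (\<lambda>n. y j n - x j n) < \<delta>) \<longrightarrow> norm (T y - T x) < \<epsilon>)"

text \<open>The set of values is bounded above for a continuous multilinear mapping.\<close>

definition multilinear_norm ::
    "nat \<Rightarrow> (nat \<Rightarrow> ereal) \<Rightarrow> ((nat \<Rightarrow> nat \<Rightarrow> complex) \<Rightarrow> 'a::complex_banach) \<Rightarrow> real"
  where "multilinear_norm m p T =
    (SUP x\<in>{x\<in>lp_prod m p. \<forall>j<m. lp_norm (p j) (x j) < 1}. norm (T x))"

definition multi_indices :: "nat \<Rightarrow> (nat \<Rightarrow> nat) set"
  where "multi_indices m = PiE {..<m} (\<lambda>_. UNIV)"

definition coefficient :: "nat \<Rightarrow> ((nat \<Rightarrow> nat \<Rightarrow> complex) \<Rightarrow> 'a) \<Rightarrow> (nat \<Rightarrow> nat) \<Rightarrow> 'a"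
  where "coefficient m T i = T (restrict (\<lambda>j. unit_vec (i j)) {..<m})"

text \<open>The inequality \<open>(\<Sum>\<^sub>i norm (b i) powr s) powr (1 / s) \<le> K\<close> over an infinite index set
  includes convergence of the series, as \<open>infsum\<close> is \<open>0\<close> on non-summable families.\<close>

definition ls_sum_le :: "(nat \<Rightarrow> nat) set \<Rightarrow> real \<Rightarrow> ((nat \<Rightarrow> nat) \<Rightarrow> 'a::real_normed_vector) \<Rightarrow> real \<Rightarrow> bool"
  where "ls_sum_le I s b K \<longleftrightarrow>
    (\<lambda>i. norm (b i) powr s) summable_on I \<and>
    (\<Sum>\<^sub>\<infinity>i\<in>I. norm (b i) powr s) powr (1 / s) \<le> K"

end

theory Submission
  imports Defs
begin

text \<open>Put \<open>A i = norm (v (coefficient m T i))\<close>, restricted to indices below \<open>n\<close>; the constants obtained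
  in the end do not depend on \<open>n\<close>, so bounds for these finite arrays suffice.

  For bounded sequences the argument is cotype against summability (\<open>mixed_sum_le\<close>). Fix a
  coordinate \<open>k\<close>. Cotype \<open>q\<close>, used once in each of the other coordinates, bounds the
  \<open>\<ell>\<^sub>q\<close> norm of \<open>A\<close> over the indices with \<open>i k = b\<close> by an average over signs of the norm of
  \<open>v (u b)\<close>, where \<open>u b\<close> is \<open>T\<close> evaluated at the \<open>b\<close>-th unit vector in coordinate \<open>k\<close> and at sign
  vectors elsewhere. For fixed signs, unimodular combinations of the vectors \<open>u b\<close> are again values of
  \<open>T\<close> on the unit balls, so \<open>u\<close> has weak \<open>\<ell>\<^sub>1\<close> norm at most the norm of \<open>T\<close>, and \<open>(r,1)\<close>-summability
  bounds \<open>(\<Sum>b. (\<Sum>i | i k = b. A i powr q) powr (r / q))\<close>. The averages have to be of the first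
  order here, while cotype is about averages of second order; \<open>kahane_khinchine\<close> compares the two.

  For finite \<open>p j\<close>, apply this to \<open>T\<close> composed with diagonal operators from bounded sequences into
  \<open>\<ell>\<^sub>p\<close>. It gives the same inequality for \<open>A\<close> multiplied by arbitrary weights \<open>x j (i j)\<close>, at
  the cost of the factors \<open>lp_norm (p j) (x j)\<close>. The weights are then removed one at a time by duality, and
  each removal lowers the reciprocal of the outer exponent by \<open>1 / p j\<close> (\<open>remove_weight\<close>,
  \<open>remove_weights\<close>). After the last removal the outer exponent is \<open>lam\<close>. The inequalities obtained for
  \<open>k = 0, \<dots>, m - 1\<close>, with exponents \<open>lam\<close> in one coordinate and \<open>q\<close> in the others, are averaged by an
  interpolation inequality of Blei (\<open>blei\<close>), and the average of the reciprocals
  \<open>1 / lam, 1 / q, \<dots>, 1 / q\<close> is \<open>1 / mu\<close>.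

  This requires \<open>lam \<le> q < \<infinity>\<close>. If \<open>q \<le> lam\<close>, then the target space also has cotype \<open>lam\<close>, and
  the inequality with \<open>lam\<close> in place of \<open>q\<close> is the claim, because then all the exponents coincide. If
  \<open>q = \<infinity>\<close>, then for vectors \<open>x 0, \<dots>, x (n - 1)\<close> the cotype inequality holds with any positive
  exponent \<open>s\<close> and the constant \<open>n powr (1 / s) * D\<close>; for fixed \<open>n\<close> the factor depending on \<open>n\<close>
  disappears as \<open>s\<close> tends to infinity.\<close>

section \<open>Finite inequalities and averages\<close>

lemma weighted_am_gm:
  fixes x \<theta> :: "'k \<Rightarrow> real"
  assumes "finite K" "\<And>k. k \<in> K \<Longrightarrow> 0 \<le> x k" "\<And>k. k \<in> K \<Longrightarrow> 0 \<le> \<theta> k" "sum \<theta> K = 1"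
  shows "(\<Prod>k\<in>K. x k powr \<theta> k) \<le> (\<Sum>k\<in>K. \<theta> k * x k)"
proof (cases "\<exists>k\<in>K. x k = 0")
  case True
  then have "(\<Prod>k\<in>K. x k powr \<theta> k) = 0" using assms(1) by (intro prod_zero) auto
  also have "\<dots> \<le> (\<Sum>k\<in>K. \<theta> k * x k)" using assms by (intro sum_nonneg) auto
  finally show ?thesis .
next
  case False
  then have pos: "x k > 0" if "k \<in> K" for k using assms(2)[OF that] that by force
  have ne: "K \<noteq> {}" using assms(4) by auto
  have "(\<Prod>k\<in>K. x k powr \<theta> k) = (\<Prod>k\<in>K. exp (\<theta> k * ln (x k)))"
    using pos by (intro prod.cong) (force simp: powr_def)+
  also have "\<dots> = exp (\<Sum>k\<in>K. \<theta> k *\<^sub>R ln (x k))" using assms(1) by (simp add: exp_sum)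
  also have "\<dots> \<le> (\<Sum>k\<in>K. \<theta> k * exp (ln (x k)))"
    using assms ne exp_convex by (intro convex_on_sum[of K UNIV exp \<theta>]) auto
  also have "\<dots> = (\<Sum>k\<in>K. \<theta> k * x k)" using pos by (intro sum.cong) auto
  finally show ?thesis .
qed

text \<open>After division by the sums on the right-hand side, this is the weighted inequality of the means for
  each \<open>i\<close>. The convention \<open>0 powr 0 = 0\<close> is harmless, as a vanishing factor on the right has vanishing
  summands on the left.\<close>

lemma holder_prod:
  fixes u :: "'k \<Rightarrow> 'i \<Rightarrow> real"
  assumes "finite I" "finite K" "\<And>k i. k \<in> K \<Longrightarrow> i \<in> I \<Longrightarrow> 0 \<le> u k i"
    and "\<And>k. k \<in> K \<Longrightarrow> 0 \<le> \<theta> k" "sum \<theta> K = 1"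
  shows "(\<Sum>i\<in>I. \<Prod>k\<in>K. u k i powr \<theta> k) \<le> (\<Prod>k\<in>K. (\<Sum>i\<in>I. u k i) powr \<theta> k)"
proof (cases "\<exists>k\<in>K. (\<Sum>i\<in>I. u k i) = 0")
  case True
  then obtain k where k: "k \<in> K" "(\<Sum>i\<in>I. u k i) = 0" by blast
  then have "u k i = 0" if "i \<in> I" for i
    using assms(1,3) that by (subst (asm) sum_nonneg_eq_0_iff) auto
  then have "(\<Sum>i\<in>I. \<Prod>k\<in>K. u k i powr \<theta> k) = 0"
    using k(1) assms(2) by (intro sum.neutral ballI prod_zero) force+
  then show ?thesis by (simp add: prod_nonneg)
next
  case False
  define U where "U k = (\<Sum>i\<in>I. u k i)" for k
  have U: "U k > 0" if "k \<in> K" for k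
    using False that sum_nonneg[of I "u k"] assms(3) unfolding U_def by (metis less_eq_real_def)
  have "(\<Sum>i\<in>I. \<Prod>k\<in>K. u k i powr \<theta> k)
      = (\<Sum>i\<in>I. (\<Prod>k\<in>K. (u k i / U k) powr \<theta> k) * (\<Prod>k\<in>K. U k powr \<theta> k))"
    using U assms(3)
    by (intro sum.cong refl, subst prod.distrib[symmetric], intro prod.cong)
      (auto simp: powr_divide less_imp_le dest: U)
  also have "\<dots> \<le> (\<Sum>i\<in>I. (\<Sum>k\<in>K. \<theta> k * (u k i / U k)) * (\<Prod>k\<in>K. U k powr \<theta> k))"
    using U assms
    by (intro sum_mono mult_right_mono weighted_am_gm prod_nonneg) (auto intro: divide_nonneg_pos)
  also have "\<dots> = (\<Sum>k\<in>K. \<theta> k * (U k / U k)) * (\<Prod>k\<in>K. U k powr \<theta> k)"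
    unfolding sum_distrib_right[symmetric]
    by (subst sum.swap) (simp only: U_def sum_distrib_left sum_divide_distrib times_divide_eq_right)
  also have "(\<Sum>k\<in>K. \<theta> k * (U k / U k)) = (\<Sum>k\<in>K. \<theta> k)"
    using U by (intro sum.cong) force+
  finally show ?thesis using assms(5) by (simp add: U_def)
qed

lemma holder_two:
  fixes f g :: "'i \<Rightarrow> real"
  assumes "finite I" "\<And>i. i \<in> I \<Longrightarrow> 0 \<le> f i" "\<And>i. i \<in> I \<Longrightarrow> 0 \<le> g i"
    and "0 \<le> s" "0 \<le> t" "s + t = 1"
  shows "(\<Sum>i\<in>I. f i powr s * g i powr t) \<le> (\<Sum>i\<in>I. f i) powr s * (\<Sum>i\<in>I. g i) powr t"
  using holder_prod[of I "UNIV :: bool set" "\<lambda>b. if b then f else g" "\<lambda>b. if b then s else t"] assms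
  by (simp add: UNIV_bool mult.commute add.commute)

definition avg :: "'s set \<Rightarrow> ('s \<Rightarrow> real) \<Rightarrow> real"
  where "avg S f = (\<Sum>s\<in>S. f s) / real (card S)"

lemma avg_mono: "(\<And>s. s \<in> S \<Longrightarrow> f s \<le> g s) \<Longrightarrow> avg S f \<le> avg S g"
  unfolding avg_def by (intro divide_right_mono sum_mono) auto

lemma avg_nonneg: "(\<And>s. s \<in> S \<Longrightarrow> 0 \<le> f s) \<Longrightarrow> 0 \<le> avg S f"
  unfolding avg_def by (intro divide_nonneg_nonneg sum_nonneg) auto

lemma avg_cong: "(\<And>s. s \<in> S \<Longrightarrow> f s = g s) \<Longrightarrow> avg S f = avg S g"
  unfolding avg_def by simp

lemma avg_cmult: "avg S (\<lambda>s. c * f s) = c * avg S f"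
  unfolding avg_def by (simp add: sum_distrib_left)

lemma avg_add: "avg S (\<lambda>s. f s + g s) = avg S f + avg S g"
  unfolding avg_def by (simp add: sum.distrib add_divide_distrib)

lemma avg_diff: "avg S (\<lambda>s. f s - g s) = avg S f - avg S g"
  unfolding avg_def by (simp add: sum_subtractf diff_divide_distrib)

lemma avg_sum: "avg S (\<lambda>s. \<Sum>i\<in>I. f i s) = (\<Sum>i\<in>I. avg S (f i))"
  unfolding avg_def by (subst sum.swap) (simp add: sum_divide_distrib)

lemma avg_const: "finite S \<Longrightarrow> S \<noteq> {} \<Longrightarrow> avg S (\<lambda>_. c) = c"
  unfolding avg_def by simp

lemma sum_PiE_insert:
  assumes "j \<notin> J"
  shows "(\<Sum>e\<in>PiE (insert j J) S. f e) = (\<Sum>s\<in>S j. \<Sum>e\<in>PiE J S. f (e(j := s)))"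
  unfolding PiE_insert_eq sum.cartesian_product
  by (subst sum.reindex[OF inj_combinator[OF assms]]) (simp add: case_prod_unfold)

lemma avg_PiE_insert:
  assumes "j \<notin> J" "finite J"
  shows "avg (PiE (insert j J) S) f = avg (S j) (\<lambda>s. avg (PiE J S) (\<lambda>e. f (e(j := s))))"
  using assms unfolding avg_def
  by (simp add: sum_PiE_insert card_PiE sum_divide_distrib mult.commute)

lemma avg_swap: "avg S (\<lambda>s. avg T (f s)) = avg T (\<lambda>t. avg S (\<lambda>s. f s t))"
  unfolding avg_def sum_divide_distrib[symmetric]
  by (subst sum.swap) (simp add: mult.commute)

text \<open>Hoelder's inequality against the constant function \<open>1\<close>.\<close>

lemma avg_powr_le:
  assumes "finite S" "\<And>s. s \<in> S \<Longrightarrow> 0 \<le> f s" "1 \<le> r"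
  shows "avg S f powr r \<le> avg S (\<lambda>s. f s powr r)"
proof (cases "S = {}")
  case True then show ?thesis by (simp add: avg_def)
next
  case False
  define c where "c = real (card S)"
  have c: "c > 0" using False assms(1) by (simp add: c_def card_gt_0_iff)
  have "(\<Sum>s\<in>S. f s) = (\<Sum>s\<in>S. (f s powr r) powr (1/r) * 1 powr (1 - 1/r))"
    using assms by (intro sum.cong) (auto simp: powr_powr)
  also have "\<dots> \<le> (\<Sum>s\<in>S. f s powr r) powr (1/r) * (\<Sum>s\<in>S. 1) powr (1 - 1/r)"
    using assms by (intro holder_two) auto
  also have "(\<Sum>s\<in>S. 1) = c" by (simp add: c_def)
  finally have "(\<Sum>s\<in>S. f s) powr r \<le> ((\<Sum>s\<in>S. f s powr r) powr (1/r) * c powr (1 - 1/r)) powr r"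
    using assms by (intro powr_mono2 sum_nonneg) auto
  also have "\<dots> = (\<Sum>s\<in>S. f s powr r) * (c powr r / c)"
  proof -
    have "(c powr (1 - 1/r)) powr r = c powr r / c"
      using assms(3) c unfolding powr_powr by (simp add: left_diff_distrib powr_diff)
    moreover have "((\<Sum>s\<in>S. f s powr r) powr (1/r)) powr r = (\<Sum>s\<in>S. f s powr r)"
      using assms(3) by (simp add: powr_powr sum_nonneg)
    ultimately show ?thesis by (simp only: powr_mult[of "_ powr _" "_ powr _"] powr_ge_zero)
  qed
  finally show ?thesis
    using c assms sum_nonneg[of S f]
    unfolding avg_def c_def[symmetric] by (simp add: powr_divide field_simps)
qed

text \<open>Minkowski's inequality for the \<open>\<ell>\<^sub>q\<close> norm. With \<open>g\<close> the average of \<open>f\<close>, write \<open>g powr q = g powr (q - 1) * g\<close>, expand the second factor as an average, and apply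
  Hoelder's inequality to each \<open>s\<close>; the norm of \<open>g\<close> then cancels.\<close>

lemma minkowski_avg:
  fixes f :: "'s \<Rightarrow> 'k \<Rightarrow> real"
  assumes "finite S" "finite K" "\<And>s k. s \<in> S \<Longrightarrow> k \<in> K \<Longrightarrow> 0 \<le> f s k" "1 \<le> q"
  shows "(\<Sum>k\<in>K. avg S (\<lambda>s. f s k) powr q) powr (1/q) \<le> avg S (\<lambda>s. (\<Sum>k\<in>K. f s k powr q) powr (1/q))"
    (is "?Z powr _ \<le> ?R")
proof (cases "?Z = 0")
  case True
  then show ?thesis by (simp add: avg_nonneg)
next
  case False
  define g where "g k = avg S (\<lambda>s. f s k)" for k
  have g: "g k \<ge> 0" if "k \<in> K" for k using assms(3) that unfolding g_def by (intro avg_nonneg) auto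
  have Z: "?Z > 0" using False sum_nonneg[of K "\<lambda>k. g k powr q"] by (simp add: g_def)
  have "?Z = (\<Sum>k\<in>K. g k powr (q - 1) * g k)"
  proof (intro sum.cong refl)
    fix k assume "k \<in> K"
    then show "avg S (\<lambda>s. f s k) powr q = g k powr (q - 1) * g k"
      using powr_mult_base[OF g, of k "q - 1"] by (simp add: g_def mult.commute)
  qed
  also have "\<dots> = avg S (\<lambda>s. \<Sum>k\<in>K. g k powr (q - 1) * f s k)"
    by (simp add: avg_sum avg_cmult g_def)
  also have "\<dots> \<le> avg S (\<lambda>s. ?Z powr (1 - 1/q) * (\<Sum>k\<in>K. f s k powr q) powr (1/q))"
  proof (rule avg_mono)
    fix s assume s: "s \<in> S"
    have "(\<Sum>k\<in>K. g k powr (q - 1) * f s k)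
        = (\<Sum>k\<in>K. (g k powr q) powr (1 - 1/q) * (f s k powr q) powr (1/q))"
      using assms s by (intro sum.cong refl) (auto simp: powr_powr algebra_simps)
    also have "\<dots> \<le> (\<Sum>k\<in>K. g k powr q) powr (1 - 1/q) * (\<Sum>k\<in>K. f s k powr q) powr (1/q)"
      using assms by (intro holder_two) auto
    finally show "(\<Sum>k\<in>K. g k powr (q - 1) * f s k)
      \<le> ?Z powr (1 - 1/q) * (\<Sum>k\<in>K. f s k powr q) powr (1/q)" by (simp add: g_def)
  qed
  finally have "?Z \<le> ?Z powr (1 - 1/q) * ?R" by (simp add: avg_cmult)
  moreover have "?Z = ?Z powr (1 - 1/q) * ?Z powr (1/q)"
    using Z by (simp add: powr_add[symmetric])
  ultimately have "?Z powr (1 - 1/q) * ?Z powr (1/q) \<le> ?Z powr (1 - 1/q) * ?R" by simp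
  then show ?thesis using Z by (subst (asm) mult_le_cancel_left_pos) auto
qed

section \<open>The Kahane-Khinchine inequality\<close>

definition signs :: "'k set \<Rightarrow> ('k \<Rightarrow> real) set"
  where "signs K = PiE K (\<lambda>_. {1, -1})"

lemma finite_signs [simp]: "finite K \<Longrightarrow> finite (signs K)"
  unfolding signs_def by (intro finite_PiE) auto

lemma signs_nonempty [simp]: "signs K \<noteq> {}"
  unfolding signs_def by (simp add: PiE_eq_empty_iff)

lemma avg_signs_insert:
  assumes "k \<notin> K" "finite K"
  shows "avg (signs (insert k K)) f
    = (avg (signs K) (\<lambda>e. f (e(k := 1))) + avg (signs K) (\<lambda>e. f (e(k := -1)))) / 2"
  unfolding signs_def avg_PiE_insert[OF assms] by (simp add: avg_def[of "{1, -1}"])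

definition flip :: "'k \<Rightarrow> ('k \<Rightarrow> real) \<Rightarrow> 'k \<Rightarrow> real"
  where "flip k e = e(k := - e k)"

lemma flip_signs: "e \<in> signs K \<Longrightarrow> k \<in> K \<Longrightarrow> flip k e \<in> signs K"
  unfolding signs_def flip_def PiE_iff extensional_def by auto

lemma flip_flip [simp]: "flip k (flip k e) = e"
  unfolding flip_def by auto

lemma avg_flip: "k \<in> K \<Longrightarrow> avg (signs K) (\<lambda>e. f (flip k e)) = avg (signs K) f"
  unfolding avg_def
  by (rule arg_cong2[where f = "(/)"], rule sum.reindex_bij_witness[of _ "flip k" "flip k"])
    (auto simp: flip_signs)

lemma avg_antipodal:
  "avg (signs K) (\<lambda>e. f (restrict (\<lambda>k. - e k) K)) = avg (signs K) f"
proof -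
  let ?a = "\<lambda>e. restrict (\<lambda>k. - e k) K"
  have a: "?a e \<in> signs K" "?a (?a e) = e" if "e \<in> signs K" for e
    using that unfolding signs_def PiE_iff by (auto simp: extensional_def)
  show ?thesis unfolding avg_def
    by (rule arg_cong2[where f = "(/)"], rule sum.reindex_bij_witness[of _ ?a ?a]) (use a in auto)
qed

text \<open>The energy of the random walk on the cube: in terms of the Walsh expansion of \<open>f\<close>, the sum over all
  \<open>A \<subseteq> K\<close> of \<open>4 * card A\<close> times the square of the coefficient belonging to \<open>A\<close>.\<close>

definition dirichlet :: "'k set \<Rightarrow> (('k \<Rightarrow> real) \<Rightarrow> real) \<Rightarrow> real"
  where "dirichlet K f = (\<Sum>k\<in>K. avg (signs K) (\<lambda>e. (f e - f (flip k e))\<^sup>2))"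

lemma half_avg: "avg S u / 2 = avg S (\<lambda>e. u e / 2)"
  unfolding avg_def by (simp add: sum_divide_distrib mult.commute)

text \<open>The functions \<open>p\<close> and \<open>g\<close> are the parts of \<open>f = p + e k * g\<close> that do not involve the sign with index
  \<open>k\<close>. Splitting off one sign at a time replaces the Walsh expansion in the inductions below.\<close>

lemma dirichlet_insert:
  fixes f p g :: "('k \<Rightarrow> real) \<Rightarrow> real"
  assumes K: "finite K" "k \<notin> K"
    and f: "\<And>e. f (e(k := 1)) = p e + g e" "\<And>e. f (e(k := -1)) = p e - g e"
  shows "dirichlet (insert k K) f
    = 4 * avg (signs K) (\<lambda>e. (g e)\<^sup>2) + dirichlet K p + dirichlet K g"
proof -
  have 1: "avg (signs (insert k K)) (\<lambda>e. (f e - f (flip k e))\<^sup>2) = 4 * avg (signs K) (\<lambda>e. (g e)\<^sup>2)"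
    unfolding avg_signs_insert[OF K(2,1)] flip_def
    by (simp add: f avg_cmult power_mult_distrib flip: mult_2)
  have 2: "avg (signs (insert k K)) (\<lambda>e. (f e - f (flip l e))\<^sup>2)
      = avg (signs K) (\<lambda>e. (p e - p (flip l e))\<^sup>2) + avg (signs K) (\<lambda>e. (g e - g (flip l e))\<^sup>2)"
    if l: "l \<in> K" for l
  proof -
    have fl: "flip l (e(k := s)) = (flip l e)(k := s)" for e s
      using K l by (auto simp: flip_def fun_upd_twist)
    show ?thesis
      unfolding avg_signs_insert[OF K(2,1)] fl f avg_add[symmetric] half_avg
      by (intro avg_cong) (simp add: power2_eq_square field_simps)
  qed
  show ?thesis
    unfolding dirichlet_def using K by (simp add: 1 2 sum.distrib)
qed

lemma avg_insert_split:
  fixes f p g :: "('k \<Rightarrow> real) \<Rightarrow> real"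
  assumes K: "finite K" "k \<notin> K"
    and f: "\<And>e. f (e(k := 1)) = p e + g e" "\<And>e. f (e(k := -1)) = p e - g e"
  shows "avg (signs (insert k K)) f = avg (signs K) p"
    and "avg (signs (insert k K)) (\<lambda>e. (f e)\<^sup>2)
      = avg (signs K) (\<lambda>e. (p e)\<^sup>2) + avg (signs K) (\<lambda>e. (g e)\<^sup>2)"
    and "avg (signs (insert k K)) (\<lambda>e. e k * f e) = avg (signs K) g"
    and "l \<in> K \<Longrightarrow> avg (signs (insert k K)) (\<lambda>e. e l * f e) = avg (signs K) (\<lambda>e. e l * p e)"
proof -
  note split = avg_signs_insert[OF K(2,1)] f avg_add[symmetric] half_avg
  show "avg (signs (insert k K)) f = avg (signs K) p"
    unfolding split by simp
  show "avg (signs (insert k K)) (\<lambda>e. (f e)\<^sup>2)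
      = avg (signs K) (\<lambda>e. (p e)\<^sup>2) + avg (signs K) (\<lambda>e. (g e)\<^sup>2)"
    unfolding split by (intro avg_cong) (simp add: power2_eq_square field_simps)
  show "avg (signs (insert k K)) (\<lambda>e. e k * f e) = avg (signs K) g"
    unfolding split by (intro avg_cong) simp
  show "avg (signs (insert k K)) (\<lambda>e. e l * f e) = avg (signs K) (\<lambda>e. e l * p e)" if "l \<in> K"
  proof -
    have "l \<noteq> k" using that K by auto
    then show ?thesis
      unfolding split by (intro avg_cong) (simp add: field_simps)
  qed
qed

lemma poincare:
  assumes "finite K"
  shows "4 * (avg (signs K) (\<lambda>e. (f e)\<^sup>2) - (avg (signs K) f)\<^sup>2) \<le> dirichlet K f"
  using assms
proof (induction K arbitrary: f)
  case empty
  then show ?case by (simp add: signs_def avg_def dirichlet_def)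
next
  case (insert k K)
  define p where "p = (\<lambda>e. (f (e(k := 1)) + f (e(k := -1))) / 2)"
  define g where "g = (\<lambda>e. (f (e(k := 1)) - f (e(k := -1))) / 2)"
  have f: "f (e(k := 1)) = p e + g e" "f (e(k := -1)) = p e - g e" for e
    by (simp_all add: p_def g_def field_simps)
  have "0 \<le> dirichlet K g"
    unfolding dirichlet_def by (intro sum_nonneg avg_nonneg) auto
  then show ?case
    using insert.IH[of p] avg_insert_split(1,2)[OF insert(1,2) f]
      dirichlet_insert[OF insert(1,2) f] by simp
qed

text \<open>A Walsh coefficient of order \<open>d\<close> enters the energy with weight \<open>4 * d\<close>, which is at least \<open>8\<close> once
  \<open>d \<ge> 2\<close>; the coefficients of order one fall short of this by \<open>4\<close> each. In the induction, coefficients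
  of order \<open>d\<close> of \<open>g\<close> have order \<open>d + 1\<close> for \<open>f\<close>, so that the usual Poincare inequality suffices for
  \<open>g\<close>.\<close>

lemma poincare_second_order:
  assumes "finite K"
  shows "8 * (avg (signs K) (\<lambda>e. (f e)\<^sup>2) - (avg (signs K) f)\<^sup>2)
    - 4 * (\<Sum>k\<in>K. (avg (signs K) (\<lambda>e. e k * f e))\<^sup>2) \<le> dirichlet K f"
  using assms
proof (induction K arbitrary: f)
  case empty
  then show ?case by (simp add: signs_def avg_def dirichlet_def)
next
  case (insert k K)
  define p where "p = (\<lambda>e. (f (e(k := 1)) + f (e(k := -1))) / 2)"
  define g where "g = (\<lambda>e. (f (e(k := 1)) - f (e(k := -1))) / 2)"
  have f: "f (e(k := 1)) = p e + g e" "f (e(k := -1)) = p e - g e" for e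
    by (simp_all add: p_def g_def field_simps)
  show ?case
    using insert.IH[of p] avg_insert_split[OF insert(1,2) f] poincare[OF insert(1), of g]
      dirichlet_insert[OF insert(1,2) f] insert(1,2)
    by simp
qed

text \<open>The argument of Latala and Oleszkiewicz. The function \<open>h\<close> is even, so its Walsh coefficients of order
  one vanish and \<open>poincare_second_order\<close> bounds \<open>dirichlet K h\<close> from below by eight times the variance
  of \<open>h\<close>. On the other hand, the triangle inequality bounds the sum of the values of \<open>h\<close> at the
  neighbours of \<open>e\<close> from below, and hence the energy from above by four times the second moment.\<close>

theorem kahane_khinchine:
  fixes x :: "'k \<Rightarrow> 'a::real_normed_vector"
  assumes "finite K"
  defines "h \<equiv> \<lambda>e. norm (\<Sum>k\<in>K. e k *\<^sub>R x k)"
  shows "avg (signs K) (\<lambda>e. (h e)\<^sup>2) \<le> 2 * (avg (signs K) h)\<^sup>2"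
proof -
  let ?E = "avg (signs K)" and ?n = "real (card K)"
  have even: "?E (\<lambda>e. e k * h e) = 0" if k: "k \<in> K" for k
  proof -
    have "?E (\<lambda>e. (restrict (\<lambda>k. - e k) K) k * h (restrict (\<lambda>k. - e k) K)) = ?E (\<lambda>e. e k * h e)"
      by (rule avg_antipodal)
    moreover have "h (restrict (\<lambda>k. - e k) K) = h e" for e
      unfolding h_def by (simp add: sum_negf)
    ultimately have "?E (\<lambda>e. (-1) * (e k * h e)) = ?E (\<lambda>e. e k * h e)" using k by simp
    then show ?thesis unfolding avg_cmult by simp
  qed
  have flips: "(?n - 2) * h e \<le> (\<Sum>k\<in>K. h (flip k e))" for e
  proof -
    have "(\<Sum>l\<in>K. flip k e l *\<^sub>R x l) = (\<Sum>l\<in>K. e l *\<^sub>R x l) - (2::real) *\<^sub>R (e k *\<^sub>R x k)" if "k \<in> K" for k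
    proof -
      have "(\<Sum>l\<in>K. flip k e l *\<^sub>R x l) = (\<Sum>l\<in>K. e l *\<^sub>R x l - (if l = k then (2::real) *\<^sub>R (e k *\<^sub>R x k) else 0))"
        by (intro sum.cong) (auto simp: flip_def scaleR_2 simp del: scaleR_scaleR)
      then show ?thesis using assms(1) that by (simp add: sum_subtractf)
    qed
    then have "(\<Sum>k\<in>K. \<Sum>l\<in>K. flip k e l *\<^sub>R x l) = (?n - 2) *\<^sub>R (\<Sum>l\<in>K. e l *\<^sub>R x l)"
      by (simp add: sum_subtractf scaleR_diff_left scaleR_sum_right[symmetric] sum_constant_scaleR
          del: scaleR_scaleR)
    then have "norm ((?n - 2) *\<^sub>R (\<Sum>l\<in>K. e l *\<^sub>R x l)) \<le> (\<Sum>k\<in>K. h (flip k e))"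
      using norm_sum[of "\<lambda>k. \<Sum>l\<in>K. flip k e l *\<^sub>R x l" K] by (simp add: h_def)
    moreover have "(?n - 2) * h e \<le> norm ((?n - 2) *\<^sub>R (\<Sum>l\<in>K. e l *\<^sub>R x l))"
      by (simp add: h_def mult_right_mono)
    ultimately show ?thesis by linarith
  qed
  have "dirichlet K h = (\<Sum>k\<in>K. ?E (\<lambda>e. (h e)\<^sup>2 + (h (flip k e))\<^sup>2 - 2 * (h e * h (flip k e))))"
    unfolding dirichlet_def by (simp add: power2_diff mult.assoc)
  also have "\<dots> = (\<Sum>k\<in>K. 2 * ?E (\<lambda>e. (h e)\<^sup>2) - 2 * ?E (\<lambda>e. h e * h (flip k e)))"
    using avg_flip[of _ K "\<lambda>e. (h e)\<^sup>2"] by (intro sum.cong) (simp_all add: avg_diff avg_add avg_cmult)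
  also have "\<dots> = 2 * ?n * ?E (\<lambda>e. (h e)\<^sup>2) - 2 * ?E (\<lambda>e. h e * (\<Sum>k\<in>K. h (flip k e)))"
    by (simp add: sum_subtractf sum_distrib_left[symmetric] avg_sum[symmetric])
  also have "\<dots> \<le> 2 * ?n * ?E (\<lambda>e. (h e)\<^sup>2) - 2 * ?E (\<lambda>e. h e * ((?n - 2) * h e))"
    using flips by (intro diff_left_mono mult_left_mono avg_mono) (auto simp: h_def)
  also have "?E (\<lambda>e. h e * ((?n - 2) * h e)) = (?n - 2) * ?E (\<lambda>e. (h e)\<^sup>2)"
    unfolding avg_cmult[symmetric] by (simp add: power2_eq_square algebra_simps)
  finally have "dirichlet K h \<le> 4 * ?E (\<lambda>e. (h e)\<^sup>2)" by (simp add: algebra_simps)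
  then show ?thesis using poincare_second_order[OF assms(1), of h] even by simp
qed

section \<open>Rademacher averages and cotype\<close>

lemma rademacher_halves:
  assumes "0 \<le> t" "1 \<le> k"
  shows "rademacher (Suc k) (t / 2) = rademacher k t"
    and "rademacher (Suc k) ((t + 1) / 2) = rademacher k t"
proof -
  show "rademacher (Suc k) (t / 2) = rademacher k t"
    by (simp add: rademacher_def mult.assoc)
  obtain l where l: "k = Suc l" using assms(2) by (cases k) auto
  have "sin (2 ^ Suc k * pi * ((t + 1) / 2)) = sin (2 ^ k * pi * t + of_int (2 ^ l) * (2 * pi))"
    by (simp add: l add_divide_distrib algebra_simps)
  also have "\<dots> = sin (2 ^ k * pi * t)"
    using sin.plus_of_int[of "2 ^ k * pi * t" "2 ^ l"] by (simp add: algebra_simps)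
  finally show "rademacher (Suc k) ((t + 1) / 2) = rademacher k t"
    by (simp add: rademacher_def)
qed

lemma rademacher_1:
  shows "0 < t \<Longrightarrow> t < 1 / 2 \<Longrightarrow> rademacher 1 t = 1"
    and "1 / 2 < t \<Longrightarrow> t < 1 \<Longrightarrow> rademacher 1 t = -1"
proof -
  assume t: "0 < t" "t < 1 / 2"
  then have "sin (2 * pi * t) > 0" by (intro sin_gt_zero) auto
  then show "rademacher 1 t = 1" by (simp add: rademacher_def)
next
  assume t: "1 / 2 < t" "t < 1"
  have "sin (2 * pi * t) < 0" using t by (intro sin_lt_zero) auto
  then show "rademacher 1 t = -1" by (simp add: rademacher_def)
qed

text \<open>On each half of the unit interval the first Rademacher function is constant, and the others are a
  rescaled copy of the whole system. The offset \<open>s\<close> lets the index set lose its least element in the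
  induction without renumbering the rest.\<close>

lemma has_integral_rademacher:
  "((\<lambda>t. F (restrict (\<lambda>k. rademacher (Suc (k - s)) t) {s..<s + N}))
     has_integral avg (signs {s..<s + N}) F) {0..1}"
proof (induction N arbitrary: s F)
  case 0
  have "((\<lambda>t. F (\<lambda>_. undefined)) has_integral F (\<lambda>_. undefined)) {0..1::real}"
    using has_integral_const_real[of "F (\<lambda>_. undefined)" 0 1] by simp
  then show ?case by (simp add: signs_def avg_def restrict_def)
next
  case (Suc N)
  let ?K = "{Suc s..<Suc s + N}"
  let ?G = "\<lambda>t. F (restrict (\<lambda>k. rademacher (Suc (k - s)) t) {s..<s + Suc N})"
  let ?H = "\<lambda>a t. F ((restrict (\<lambda>k. rademacher (Suc (k - Suc s)) t) ?K)(s := a))"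
  have K: "{s..<s + Suc N} = insert s ?K" by auto
  have H: "(?H a has_integral avg (signs ?K) (\<lambda>e. F (e(s := a)))) {0..1}" for a
    using Suc.IH[of "\<lambda>e. F (e(s := a))" "Suc s"] .
  have step: "?G t = ?H a t'"
    if "rademacher 1 t = a" "\<And>k. 1 \<le> k \<Longrightarrow> rademacher (Suc k) t = rademacher k t'" for t a t'
  proof -
    have "restrict (\<lambda>k. rademacher (Suc (k - s)) t) {s..<s + Suc N}
      = (restrict (\<lambda>k. rademacher (Suc (k - Suc s)) t') ?K)(s := a)"
      using that by (auto simp: fun_eq_iff restrict_def Suc_diff_Suc)
    then show ?thesis by simp
  qed
  have "((\<lambda>t. ?H 1 (2 * t)) has_integral avg (signs ?K) (\<lambda>e. F (e(s := 1))) / 2) {0..1/2}"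
    using has_integral_affinity'[of "?H 1" _ 0 1 2 0] H by simp
  then have 1: "(?G has_integral avg (signs ?K) (\<lambda>e. F (e(s := 1))) / 2) {0..1/2}"
    unfolding cbox_interval[symmetric]
  proof (rule has_integral_spike_interior)
    fix t :: real assume "t \<in> box 0 (1/2)"
    then show "?G t = ?H 1 (2 * t)"
      using rademacher_halves(1)[of "2 * t"] rademacher_1(1)[of t] by (intro step) auto
  qed
  have "((\<lambda>t. ?H (-1) (2 * t - 1)) has_integral avg (signs ?K) (\<lambda>e. F (e(s := -1))) / 2) {1/2..1}"
    using has_integral_affinity'[of "?H (-1)" _ 0 1 2 "-1"] H by simp
  then have 2: "(?G has_integral avg (signs ?K) (\<lambda>e. F (e(s := -1))) / 2) {1/2..1}"
    unfolding cbox_interval[symmetric]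
  proof (rule has_integral_spike_interior)
    fix t :: real assume "t \<in> box (1/2) 1"
    then show "?G t = ?H (-1) (2 * t - 1)"
      using rademacher_halves(2)[of "2 * t - 1"] rademacher_1(2)[of t] by (intro step) auto
  qed
  show ?case
    using has_integral_combine[OF _ _ 1 2] unfolding K
    by (subst avg_signs_insert) (auto simp: add_divide_distrib)
qed

text \<open>The cotype inequality for at most \<open>n\<close> vectors, with averages of first order on the right-hand side.
  The number of vectors is a parameter because the constant depends on it for infinite cotype.\<close>

definition rad_cotype :: "'a::real_normed_vector itself \<Rightarrow> real \<Rightarrow> real \<Rightarrow> nat \<Rightarrow> bool"
  where "rad_cotype _ q D n \<longleftrightarrow> (\<forall>x :: nat \<Rightarrow> 'a.
    (\<Sum>k<n. norm (x k) powr q) powr (1 / q)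
      \<le> D * avg (signs {..<n}) (\<lambda>e. norm (\<Sum>k<n. e k *\<^sub>R x k)))"

lemma rademacher_integral_le:
  fixes x :: "nat \<Rightarrow> 'a::complex_banach"
  shows "sqrt (integral {0..1} (\<lambda>t. (norm (\<Sum>k\<in>{1..n}. rademacher k t *\<^sub>R x (k - 1)))\<^sup>2))
    \<le> sqrt 2 * avg (signs {..<n}) (\<lambda>e. norm (\<Sum>k<n. e k *\<^sub>R x k))"
proof -
  let ?F = "\<lambda>e. norm (\<Sum>k<n. e k *\<^sub>R x k)"
  have eq: "(\<Sum>k\<in>{1..n}. rademacher k t *\<^sub>R x (k - 1))
      = (\<Sum>k<n. restrict (\<lambda>k. rademacher (Suc k) t) {..<n} k *\<^sub>R x k)" for t
    by (rule sum.reindex_bij_witness[of _ Suc "\<lambda>k. k - 1"]) auto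
  have "((\<lambda>t. (?F (restrict (\<lambda>k. rademacher (Suc k) t) {..<n}))\<^sup>2)
      has_integral avg (signs {..<n}) (\<lambda>e. (?F e)\<^sup>2)) {0..1}"
    using has_integral_rademacher[of "\<lambda>e. (?F e)\<^sup>2" 0 n] by (simp add: atLeast0LessThan)
  then have "sqrt (integral {0..1} (\<lambda>t. (norm (\<Sum>k\<in>{1..n}. rademacher k t *\<^sub>R x (k - 1)))\<^sup>2))
      = sqrt (avg (signs {..<n}) (\<lambda>e. (?F e)\<^sup>2))"
    unfolding eq by (simp only: integral_unique)
  also have "\<dots> \<le> sqrt (2 * (avg (signs {..<n}) ?F)\<^sup>2)"
    by (intro real_sqrt_le_mono kahane_khinchine) simp
  also have "\<dots> = sqrt 2 * avg (signs {..<n}) ?F"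
    by (simp add: real_sqrt_mult avg_nonneg)
  finally show ?thesis .
qed

text \<open>Bounding \<open>a i powr (s - 1)\<close> by \<open>sum a I powr (s - 1)\<close> gives the embedding of \<open>\<ell>\<^sub>1\<close> into \<open>\<ell>\<^sub>s\<close>, which
  lets cotype pass to larger exponents.\<close>

lemma sum_powr_le_powr_sum:
  fixes a :: "'i \<Rightarrow> real"
  assumes "finite I" "\<And>i. i \<in> I \<Longrightarrow> 0 \<le> a i" "1 \<le> s"
  shows "(\<Sum>i\<in>I. a i powr s) \<le> (\<Sum>i\<in>I. a i) powr s"
proof (cases "sum a I = 0")
  case True
  then have "a i = 0" if "i \<in> I" for i
    using that assms(1,2) by (subst (asm) sum_nonneg_eq_0_iff) auto
  then show ?thesis by simp
next
  case False
  then have pos: "sum a I > 0" using sum_nonneg[of I a] assms(2) by force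
  have "a i powr s \<le> a i * sum a I powr (s - 1)" if i: "i \<in> I" for i
  proof -
    have "a i powr s = a i * a i powr (s - 1)" using assms(2)[OF i] by (simp add: powr_mult_base)
    also have "\<dots> \<le> a i * sum a I powr (s - 1)"
      using assms i by (intro mult_left_mono powr_mono2 member_le_sum) auto
    finally show ?thesis .
  qed
  then have "(\<Sum>i\<in>I. a i powr s) \<le> (\<Sum>i\<in>I. a i * sum a I powr (s - 1))" by (rule sum_mono)
  also have "\<dots> = sum a I powr s"
    using pos by (simp add: sum_distrib_right[symmetric] powr_mult_base)
  finally show ?thesis .
qed

lemma has_cotype_finite:
  assumes "has_cotype TYPE('a::complex_banach) q" "q \<le> ereal s"
  shows "\<exists>D>0. \<forall>n. rad_cotype TYPE('a) s D n"
proof -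
  obtain q' where q: "q = ereal q'" using assms by (cases q) (auto simp: has_cotype_def)
  have q': "2 \<le> q'" "q' \<le> s" using assms by (auto simp: q has_cotype_def)
  obtain C where C: "C > 0" and
    cot: "\<forall>n (x :: nat \<Rightarrow> 'a). (\<Sum>k\<in>{1..n}. norm (x k) powr q') powr (1 / q')
      \<le> C * sqrt (integral {0..1} (\<lambda>t. (norm (\<Sum>k\<in>{1..n}. rademacher k t *\<^sub>R x k))\<^sup>2))"
    using assms(1) unfolding has_cotype_def q Let_def by auto
  have "rad_cotype TYPE('a) s (C * sqrt 2) n" for n
    unfolding rad_cotype_def
  proof
    fix x :: "nat \<Rightarrow> 'a"
    have "(\<Sum>k<n. norm (x k) powr s) powr (1 / s)
      \<le> ((\<Sum>k<n. norm (x k) powr q') powr (s / q')) powr (1 / s)"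
      using sum_powr_le_powr_sum[of "{..<n}" "\<lambda>k. norm (x k) powr q'" "s / q'"] q'
      by (intro powr_mono2) (auto simp: powr_powr intro: sum_nonneg)
    also have "\<dots> = (\<Sum>k<n. norm (x k) powr q') powr (1 / q')"
      using q' by (simp add: powr_powr)
    also have "(\<Sum>k<n. norm (x k) powr q') = (\<Sum>k\<in>{1..n}. norm (x (k - 1)) powr q')"
      by (rule sum.reindex_bij_witness[of _ "\<lambda>k. k - 1" Suc]) auto
    also have "\<dots> powr (1 / q') \<le> C * sqrt (integral {0..1}
        (\<lambda>t. (norm (\<Sum>k\<in>{1..n}. rademacher k t *\<^sub>R x (k - 1)))\<^sup>2))"
      using cot[rule_format, of "\<lambda>k. x (k - 1)" n] .
    also have "\<dots> \<le> C * (sqrt 2 * avg (signs {..<n}) (\<lambda>e. norm (\<Sum>k<n. e k *\<^sub>R x k)))"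
      using C by (intro mult_left_mono rademacher_integral_le) auto
    finally show "(\<Sum>k<n. norm (x k) powr s) powr (1 / s)
        \<le> C * sqrt 2 * avg (signs {..<n}) (\<lambda>e. norm (\<Sum>k<n. e k *\<^sub>R x k))"
      by (simp only: mult.assoc)
  qed
  then show ?thesis using C by (intro exI[of _ "C * sqrt 2"]) auto
qed

text \<open>The \<open>\<ell>\<^sub>s\<close> norm of \<open>n\<close> numbers is at most \<open>n powr (1 / s)\<close> times their maximum.\<close>

lemma has_cotype_infinity:
  assumes "has_cotype TYPE('a::complex_banach) \<infinity>"
  shows "\<exists>D>0. \<forall>n s. 0 < s \<longrightarrow> rad_cotype TYPE('a) s (real n powr (1 / s) * D) n"
proof -
  obtain C where C: "C > 0" and
    cot: "\<forall>n (x :: nat \<Rightarrow> 'a). \<forall>k\<in>{1..n}. norm (x k)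
      \<le> C * sqrt (integral {0..1} (\<lambda>t. (norm (\<Sum>k\<in>{1..n}. rademacher k t *\<^sub>R x k))\<^sup>2))"
    using assms unfolding has_cotype_def Let_def by auto
  have "rad_cotype TYPE('a) s (real n powr (1 / s) * (C * sqrt 2)) n" if s: "0 < s" for n s
    unfolding rad_cotype_def
  proof
    fix x :: "nat \<Rightarrow> 'a"
    define R where "R = C * sqrt 2 * avg (signs {..<n}) (\<lambda>e. norm (\<Sum>k<n. e k *\<^sub>R x k))"
    have R: "0 \<le> R" using C by (auto simp: R_def intro!: avg_nonneg mult_nonneg_nonneg)
    have "norm (x k) \<le> R" if "k < n" for k
    proof -
      have "norm (x (Suc k - 1)) \<le> C * sqrt (integral {0..1}
        (\<lambda>t. (norm (\<Sum>k\<in>{1..n}. rademacher k t *\<^sub>R x (k - 1)))\<^sup>2))"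
        using that by (intro cot[rule_format, of "Suc k" n "\<lambda>k. x (k - 1)"]) auto
      also have "\<dots> \<le> C * (sqrt 2 * avg (signs {..<n}) (\<lambda>e. norm (\<Sum>k<n. e k *\<^sub>R x k)))"
        using C by (intro mult_left_mono rademacher_integral_le) auto
      finally show ?thesis by (simp add: R_def)
    qed
    then have "(\<Sum>k<n. norm (x k) powr s) powr (1 / s) \<le> (\<Sum>k<n. R powr s) powr (1 / s)"
      using s by (intro powr_mono2 sum_mono sum_nonneg) auto
    also have "\<dots> = real n powr (1 / s) * R"
      using s R by (simp add: powr_mult powr_powr)
    finally show "(\<Sum>k<n. norm (x k) powr s) powr (1 / s) \<le> real n powr (1 / s) * (C * sqrt 2)
        * avg (signs {..<n}) (\<lambda>e. norm (\<Sum>k<n. e k *\<^sub>R x k))"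
      by (simp add: R_def)
  qed
  then show ?thesis using C by (intro exI[of _ "C * sqrt 2"]) auto
qed

section \<open>Cotype in several coordinates and summing operators\<close>

text \<open>Induction on the number of coordinates: for a fixed index \<open>b\<close> in the new coordinate the induction
  hypothesis applies, \<open>minkowski_avg\<close> moves the average over the old signs outside of the \<open>\<ell>\<^sub>q\<close> norm
  over \<open>b\<close>, and cotype applies to what remains inside. This order of operations is possible because
  the averages are of first order.\<close>

lemma multiple_cotype:
  fixes y :: "('j \<Rightarrow> nat) \<Rightarrow> 'a::real_normed_vector"
  assumes cot: "rad_cotype TYPE('a) q D n" and "1 \<le> q" "0 \<le> D" "finite J"
  shows "(\<Sum>i\<in>PiE J (\<lambda>_. {..<n}). norm (y i) powr q) powr (1 / q)
    \<le> D ^ card J * avg (PiE J (\<lambda>_. signs {..<n}))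
        (\<lambda>e. norm (\<Sum>i\<in>PiE J (\<lambda>_. {..<n}). (\<Prod>j\<in>J. e j (i j)) *\<^sub>R y i))"
  using assms(4)
proof (induction J arbitrary: y)
  case empty
  then show ?case using assms(2) by (simp add: avg_def powr_powr)
next
  case (insert j J)
  let ?I = "PiE J (\<lambda>_. {..<n})" and ?E = "PiE J (\<lambda>_. signs {..<n})"
  let ?u = "\<lambda>e b. \<Sum>i\<in>?I. (\<Prod>l\<in>J. e l (i l)) *\<^sub>R y (i(j := b))"
  have fin: "finite ?E" using insert.hyps by (intro finite_PiE) auto
  have upd: "(\<Prod>l\<in>insert j J. (e(j := s)) l ((i(j := b)) l)) = s b * (\<Prod>l\<in>J. e l (i l))"
    for e :: "'j \<Rightarrow> nat \<Rightarrow> real" and s i b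
  proof -
    have "(\<Prod>l\<in>J. (e(j := s)) l ((i(j := b)) l)) = (\<Prod>l\<in>J. e l (i l))"
      using insert.hyps by (intro prod.cong) auto
    then show ?thesis using insert.hyps by simp
  qed
  have expand: "(\<Sum>i\<in>PiE (insert j J) (\<lambda>_. {..<n}). (\<Prod>l\<in>insert j J. (e(j := s)) l (i l)) *\<^sub>R y i)
      = (\<Sum>b<n. s b *\<^sub>R ?u e b)" for e s
    unfolding sum_PiE_insert[OF insert.hyps(2)] upd scaleR_sum_right scaleR_scaleR ..
  have "(\<Sum>i\<in>PiE (insert j J) (\<lambda>_. {..<n}). norm (y i) powr q) powr (1 / q)
      = (\<Sum>b<n. ((\<Sum>i\<in>?I. norm (y (i(j := b))) powr q) powr (1 / q)) powr q) powr (1 / q)"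
    using assms(2) insert.hyps by (simp add: sum_PiE_insert powr_powr sum_nonneg)
  also have "\<dots> \<le> (\<Sum>b<n. (D ^ card J * avg ?E (\<lambda>e. norm (?u e b))) powr q) powr (1 / q)"
    using assms(2) insert.IH by (intro powr_mono2 sum_mono) (auto intro: sum_nonneg)
  also have "\<dots> = D ^ card J * (\<Sum>b<n. avg ?E (\<lambda>e. norm (?u e b)) powr q) powr (1 / q)"
    using assms(2,3)
    by (simp add: powr_mult avg_nonneg sum_distrib_left[symmetric] sum_nonneg powr_powr)
  also have "\<dots> \<le> D ^ card J * avg ?E (\<lambda>e. (\<Sum>b<n. norm (?u e b) powr q) powr (1 / q))"
    using assms(2,3) fin by (intro mult_left_mono minkowski_avg) auto
  also have "\<dots> \<le> D ^ card J * avg ?E (\<lambda>e. D * avg (signs {..<n}) (\<lambda>s. norm (\<Sum>b<n. s b *\<^sub>R ?u e b)))"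
    using assms(3) cot unfolding rad_cotype_def by (intro mult_left_mono avg_mono) auto
  also have "\<dots> = D ^ card (insert j J) * avg (PiE (insert j J) (\<lambda>_. signs {..<n}))
      (\<lambda>e. norm (\<Sum>i\<in>PiE (insert j J) (\<lambda>_. {..<n}). (\<Prod>l\<in>insert j J. e l (i l)) *\<^sub>R y i))"
    unfolding avg_PiE_insert[OF insert.hyps(2,1)] expand avg_cmult
    using insert.hyps by (subst avg_swap) (simp add: mult.assoc mult.left_commute)
  finally show ?case .
qed

lemma zero_in_dual_ball: "(\<lambda>_. 0) \<in> dual_ball"
  by (simp add: dual_ball_def bounded_clinear_def scaleC_complex_def onorm_zero)

lemma scaleC_sum_right: "c *\<^sub>C (\<Sum>b\<in>B. u b) = (\<Sum>b\<in>B. c *\<^sub>C u b)"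
proof -
  have "c *\<^sub>C (0::'a) = 0" using scaleC_add_right[of c "0::'a" 0] by simp
  then show ?thesis by (induction B rule: infinite_finite_induct) (simp_all add: scaleC_add_right)
qed

lemma bounded_clinear_sum_scaleC:
  assumes "bounded_clinear f"
  shows "f (\<Sum>b\<in>B. c b *\<^sub>C u b) = (\<Sum>b\<in>B. c b *\<^sub>C f (u b))"
  using assms unfolding bounded_clinear_def by (simp add: linear_sum bounded_linear.linear)

text \<open>Choosing \<open>c b\<close> with \<open>c b * f (u b) = cmod (f (u b))\<close> makes the left-hand side a value of \<open>f\<close> at a
  unimodular combination of the vectors \<open>u b\<close>.\<close>

lemma weak_l1_norm_le:
  fixes u :: "'b \<Rightarrow> 'x::complex_normed_vector"
  assumes "f \<in> dual_ball" and B: "\<And>c. (\<And>b. cmod (c b) = 1) \<Longrightarrow> norm (\<Sum>b\<in>S. c b *\<^sub>C u b) \<le> B"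
  shows "(\<Sum>b\<in>S. cmod (f (u b))) \<le> B"
proof -
  define c where "c b = (if f (u b) = 0 then 1 else cnj (f (u b)) / of_real (cmod (f (u b))))" for b
  have c: "cmod (c b) = 1" for b by (auto simp: c_def norm_divide)
  have cf: "c b * f (u b) = of_real (cmod (f (u b)))" for b
    by (auto simp: c_def complex_norm_square[symmetric] mult.commute power2_eq_square)
  have f: "bounded_linear f" "bounded_clinear f" "onorm f \<le> 1"
    using assms(1) by (auto simp: dual_ball_def bounded_clinear_def)
  have "complex_of_real (\<Sum>b\<in>S. cmod (f (u b))) = f (\<Sum>b\<in>S. c b *\<^sub>C u b)"
    unfolding bounded_clinear_sum_scaleC[OF f(2)] by (simp add: scaleC_complex_def cf)
  then have "\<bar>\<Sum>b\<in>S. cmod (f (u b))\<bar> = cmod (f (\<Sum>b\<in>S. c b *\<^sub>C u b))"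
    by (metis norm_of_real)
  also have "\<dots> \<le> onorm f * norm (\<Sum>b\<in>S. c b *\<^sub>C u b)"
    by (rule onorm[OF f(1)])
  also have "\<dots> \<le> 1 * B"
    using f(3) B[of c] c onorm_pos_le[OF f(1)] by (intro mult_mono) auto
  finally show ?thesis by simp
qed

text \<open>Being \<open>(r,1)\<close>-summing with constant \<open>C\<close>, where unimodular combinations of the vectors measure the
  weak \<open>\<ell>\<^sub>1\<close> norm in place of functionals. In this form it applies directly to multilinear mappings,
  whose unimodular combinations of coefficients are values.\<close>

definition summing_with :: "real \<Rightarrow> real \<Rightarrow> ('x::complex_banach \<Rightarrow> 'y::complex_banach) \<Rightarrow> bool"
  where "summing_with r C v \<longleftrightarrow> (\<forall>(n::nat) u B. 0 \<le> B \<longrightarrow>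
    (\<forall>c. (\<forall>b. cmod (c b) = 1) \<longrightarrow> norm (\<Sum>b<n. c b *\<^sub>C u b) \<le> B) \<longrightarrow>
    (\<Sum>b<n. norm (v (u b)) powr r) \<le> (C * B) powr r)"

lemma summing_operator_with:
  fixes v :: "'x::complex_banach \<Rightarrow> 'y::complex_banach"
  assumes "summing_operator r 1 v"
  shows "bounded_clinear v" and "\<exists>C>0. summing_with r C v"
proof -
  show "bounded_clinear v" using assms by (simp add: summing_operator_def)
  have r: "1 \<le> r" using assms by (simp add: summing_operator_def)
  obtain C where C: "C > 0" and le: "\<forall>(n::nat) x. (\<Sum>k\<in>{1..n}. norm (v (x k)) powr r) powr (1 / r)
        \<le> C * (SUP f\<in>dual_ball. (\<Sum>k\<in>{1..n}. cmod (f (x k)) powr 1) powr (1 / 1))"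
    using assms unfolding summing_operator_def by blast
  have "summing_with r C v"
    unfolding summing_with_def
  proof (intro allI impI)
    fix n :: nat and u :: "nat \<Rightarrow> 'x" and B
    assume B: "0 \<le> B" and uB: "\<forall>c. (\<forall>b. cmod (c b) = 1) \<longrightarrow> norm (\<Sum>b<n. c b *\<^sub>C u b) \<le> B"
    have shift: "(\<Sum>b\<in>{1..n}. g (b - 1)) = (\<Sum>b<n. g b)" for g :: "nat \<Rightarrow> real"
      by (rule sum.reindex_bij_witness[of _ Suc "\<lambda>k. k - 1"]) auto
    have "(\<Sum>b<n. norm (v (u b)) powr r) powr (1 / r)
        \<le> C * (SUP f\<in>dual_ball. (\<Sum>k\<in>{1..n}. cmod (f (u (k - 1))) powr 1) powr (1 / 1))"
      using le[rule_format, of "\<lambda>k. u (k - 1)" n] shift[of "\<lambda>b. norm (v (u b)) powr r"] by simp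
    also have "\<dots> \<le> C * B"
    proof (intro mult_left_mono cSUP_least)
      fix f :: "'x \<Rightarrow> complex" assume f: "f \<in> dual_ball"
      have "(\<Sum>b<n. cmod (f (u b))) \<le> B"
        using uB by (intro weak_l1_norm_le[OF f]) auto
      then show "(\<Sum>k\<in>{1..n}. cmod (f (u (k - 1))) powr 1) powr (1 / 1) \<le> B"
        using shift[of "\<lambda>b. cmod (f (u b))"] by (simp add: sum_nonneg)
    qed (use C zero_in_dual_ball in auto)
    finally have "((\<Sum>b<n. norm (v (u b)) powr r) powr (1 / r)) powr r \<le> (C * B) powr r"
      using r by (intro powr_mono2) auto
    then show "(\<Sum>b<n. norm (v (u b)) powr r) \<le> (C * B) powr r"
      using r by (simp add: powr_powr sum_nonneg)
  qed
  then show "\<exists>C>0. summing_with r C v" using C by blast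
qed

lemma sum_fiber_PiE:
  fixes g :: "('j \<Rightarrow> nat) \<Rightarrow> real"
  assumes "k \<in> M" "b < n" "finite M"
  shows "(\<Sum>i\<in>{i \<in> PiE M (\<lambda>_. {..<n}). i k = b}. g i) = (\<Sum>i\<in>PiE (M - {k}) (\<lambda>_. {..<n}). g (i(k := b)))"
proof -
  have M: "M = insert k (M - {k})" using assms(1) by auto
  have fin: "finite (PiE M (\<lambda>_. {..<n}))" using assms(3) by (intro finite_PiE) auto
  have "(\<Sum>i\<in>{i \<in> PiE M (\<lambda>_. {..<n}). i k = b}. g i)
      = (\<Sum>i\<in>PiE M (\<lambda>_. {..<n}). if i k = b then g i else 0)"
    using fin by (simp add: sum.inter_filter)
  also have "\<dots> = (\<Sum>a<n. \<Sum>i\<in>PiE (M - {k}) (\<lambda>_. {..<n}). if a = b then g (i(k := a)) else 0)"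
    by (subst M, subst sum_PiE_insert) auto
  also have "\<dots> = (\<Sum>a<n. if a = b then (\<Sum>i\<in>PiE (M - {k}) (\<lambda>_. {..<n}). g (i(k := a))) else 0)"
    by (intro sum.cong) auto
  also have "\<dots> = (\<Sum>i\<in>PiE (M - {k}) (\<lambda>_. {..<n}). g (i(k := b)))"
    using assms(2) by simp
  finally show ?thesis .
qed

text \<open>The main inequality for \<open>p j = \<infinity>\<close>: the hypothesis on \<open>a\<close> holds for the coefficients of a multilinear
  mapping of norm \<open>B\<close> on bounded sequences. The exponent \<open>r\<close> belongs to the coordinate \<open>k\<close>, where the
  summing operator acts, and \<open>q\<close> to the others, where cotype acts.\<close>

lemma mixed_sum_le:
  fixes v :: "'x::complex_banach \<Rightarrow> 'y::complex_banach" and a :: "('j \<Rightarrow> nat) \<Rightarrow> 'x"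
  assumes cot: "rad_cotype TYPE('y) q D n" and D: "0 \<le> D"
    and v: "bounded_clinear v" "summing_with r C v" and C: "0 \<le> C"
    and r: "1 \<le> r" "r \<le> q"
    and M: "finite M" "k \<in> M"
    and B: "0 \<le> B" "\<And>c. (\<And>j b. cmod (c j b) = 1)
      \<Longrightarrow> norm (\<Sum>i\<in>PiE M (\<lambda>_. {..<n}). (\<Prod>j\<in>M. c j (i j)) *\<^sub>C a i) \<le> B"
  shows "(\<Sum>b<n. (\<Sum>i\<in>{i \<in> PiE M (\<lambda>_. {..<n}). i k = b}. norm (v (a i)) powr q) powr (r / q))
    \<le> (C * D ^ (card M - 1) * B) powr r"
proof -
  let ?J = "M - {k}"
  let ?I = "PiE ?J (\<lambda>_. {..<n})" and ?E = "PiE ?J (\<lambda>_. signs {..<n})"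
  have J: "finite ?J" "M = insert k ?J" "k \<notin> ?J" "card ?J = card M - 1" using M by auto
  have fin: "finite ?E" using J(1) by (intro finite_PiE) auto
  have ne: "?E \<noteq> {}" by (simp add: PiE_eq_empty_iff)
  define u where "u e b = (\<Sum>i\<in>?I. complex_of_real (\<Prod>j\<in>?J. e j (i j)) *\<^sub>C a (i(k := b)))" for e b
  have vu: "v (u e b) = (\<Sum>i\<in>?I. (\<Prod>j\<in>?J. e j (i j)) *\<^sub>R v (a (i(k := b))))" for e b
    unfolding u_def bounded_clinear_sum_scaleC[OF v(1)] by (simp add: scaleR_scaleC)
  have u: "norm (\<Sum>b<n. c b *\<^sub>C u e b) \<le> B" if e: "e \<in> ?E" and c: "\<forall>b. cmod (c b) = 1" for e c
  proof -
    \<comment> \<open>signs outside of \<open>k\<close> and \<open>c\<close> in the coordinate \<open>k\<close>, made unimodular at all indices\<close>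
    define d where "d j b = (if j = k then c b
      else if j \<in> M \<and> b < n then complex_of_real (e j b) else 1)" for j b
    have "cmod (d j b) = 1" for j b
    proof (cases "j \<noteq> k \<and> j \<in> M \<and> b < n")
      case True
      then have "e j \<in> signs {..<n}" using e by (auto dest: PiE_mem)
      then have "e j b \<in> {1, -1}" using True unfolding signs_def by (auto dest: PiE_mem)
      then show ?thesis using True by (auto simp: d_def)
    qed (use c in \<open>auto simp: d_def\<close>)
    then have "norm (\<Sum>i\<in>PiE M (\<lambda>_. {..<n}). (\<Prod>j\<in>M. d j (i j)) *\<^sub>C a i) \<le> B" by (rule B(2))
    also have "(\<Sum>i\<in>PiE M (\<lambda>_. {..<n}). (\<Prod>j\<in>M. d j (i j)) *\<^sub>C a i)
        = (\<Sum>b<n. \<Sum>i\<in>?I. (\<Prod>j\<in>M. d j ((i(k := b)) j)) *\<^sub>C a (i(k := b)))"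
      by (subst (1) J(2), subst sum_PiE_insert[OF J(3)]) simp
    also have "\<dots> = (\<Sum>b<n. \<Sum>i\<in>?I. c b *\<^sub>C (complex_of_real (\<Prod>j\<in>?J. e j (i j)) *\<^sub>C a (i(k := b))))"
    proof (intro sum.cong refl)
      fix b i assume i: "i \<in> ?I"
      have "(\<Prod>j\<in>M. d j ((i(k := b)) j)) = d k b * (\<Prod>j\<in>?J. d j ((i(k := b)) j))"
        using prod.insert[OF J(1,3), of "\<lambda>j. d j ((i(k := b)) j)"] J(2) by simp
      also have "(\<Prod>j\<in>?J. d j ((i(k := b)) j)) = (\<Prod>j\<in>?J. complex_of_real (e j (i j)))"
        using i by (intro prod.cong) (auto simp: d_def dest: PiE_mem)
      finally show "(\<Prod>j\<in>M. d j ((i(k := b)) j)) *\<^sub>C a (i(k := b))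
          = c b *\<^sub>C (complex_of_real (\<Prod>j\<in>?J. e j (i j)) *\<^sub>C a (i(k := b)))"
        by (simp add: scaleC_scaleC d_def)
    qed
    also have "\<dots> = (\<Sum>b<n. c b *\<^sub>C u e b)"
      unfolding u_def scaleC_sum_right ..
    finally show ?thesis .
  qed
  have "(\<Sum>b<n. (\<Sum>i\<in>{i \<in> PiE M (\<lambda>_. {..<n}). i k = b}. norm (v (a i)) powr q) powr (r / q))
      = (\<Sum>b<n. ((\<Sum>i\<in>?I. norm (v (a (i(k := b)))) powr q) powr (1 / q)) powr r)"
    using M by (intro sum.cong) (auto simp: sum_fiber_PiE powr_powr)
  also have "\<dots> \<le> (\<Sum>b<n. (D ^ card ?J * avg ?E (\<lambda>e. norm (v (u e b)))) powr r)"
    using multiple_cotype[OF cot _ D J(1)] r unfolding vu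
    by (intro sum_mono powr_mono2) auto
  also have "\<dots> = (D ^ card ?J) powr r * (\<Sum>b<n. avg ?E (\<lambda>e. norm (v (u e b))) powr r)"
    using D by (simp add: powr_mult avg_nonneg sum_distrib_left)
  also have "\<dots> \<le> (D ^ card ?J) powr r * (\<Sum>b<n. avg ?E (\<lambda>e. norm (v (u e b)) powr r))"
    using r fin by (intro mult_left_mono sum_mono avg_powr_le) auto
  also have "\<dots> = (D ^ card ?J) powr r * avg ?E (\<lambda>e. \<Sum>b<n. norm (v (u e b)) powr r)"
    by (simp add: avg_sum)
  also have "\<dots> \<le> (D ^ card ?J) powr r * avg ?E (\<lambda>e. (C * B) powr r)"
    using v(2) B(1) u unfolding summing_with_def by (intro mult_left_mono avg_mono) auto
  also have "\<dots> = (C * D ^ (card M - 1) * B) powr r"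
    using B(1) C D fin ne J(4) by (simp add: avg_const powr_mult ac_simps)
  finally show ?thesis .
qed

section \<open>Removing weights from mixed sums\<close>

text \<open>The extremal case of Hoelder's inequality: the weight \<open>y b = U b powr (\<alpha> / P)\<close> turns both
  sides of the hypothesis into powers of \<open>\<Sum>b\<in>S. U b powr \<alpha>\<close>.\<close>

lemma sum_powr_le_by_duality:
  fixes U :: "'b \<Rightarrow> real"
  assumes "finite S" "0 < \<beta>" "0 < P" "0 < \<alpha>" "1 / \<alpha> = 1 / \<beta> - 1 / P"
    and U: "\<And>b. b \<in> S \<Longrightarrow> 0 \<le> U b" and K: "0 \<le> K"
    and hyp: "\<And>y. (\<And>b. 0 \<le> y b) \<Longrightarrow>
      (\<Sum>b\<in>S. U b powr \<beta> * y b powr \<beta>) \<le> K * (\<Sum>b\<in>S. y b powr P) powr (\<beta> / P)"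
  shows "(\<Sum>b\<in>S. U b powr \<alpha>) \<le> K powr (\<alpha> / \<beta>)"
proof -
  \<comment> \<open>With the extremal weight the hypothesis becomes \<open>Z \<le> K * Z powr (1 - \<beta> / \<alpha>)\<close>.\<close>
  define Z where "Z = (\<Sum>b\<in>S. U b powr \<alpha>)"
  have Z0: "0 \<le> Z" by (simp add: Z_def sum_nonneg)
  have e1: "\<alpha> = \<beta> + \<alpha> * \<beta> / P" and e2: "\<beta> / P = 1 - \<beta> / \<alpha>"
    using assms(2-5) by (auto simp: field_simps)
  have "U b powr \<beta> * (U b powr (\<alpha> / P)) powr \<beta> = U b powr \<alpha>" for b
    using e1 by (simp add: powr_powr powr_add[symmetric])
  moreover have "(\<Sum>b\<in>S. (U b powr (\<alpha> / P)) powr P) = Z"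
    using assms(3) by (simp add: powr_powr Z_def)
  ultimately have "Z \<le> K * Z powr (1 - \<beta> / \<alpha>)"
    using hyp[of "\<lambda>b. U b powr (\<alpha> / P)"] by (simp add: Z_def e2)
  show ?thesis
  proof (cases "Z = 0")
    case False
    then have Z: "Z > 0" using Z0 by simp
    have "Z powr (\<beta> / \<alpha>) * Z powr (1 - \<beta> / \<alpha>) = Z"
      using Z by (simp add: powr_add[symmetric])
    with \<open>Z \<le> K * Z powr (1 - \<beta> / \<alpha>)\<close> have "Z powr (\<beta> / \<alpha>) \<le> K"
      using Z by (metis mult_le_cancel_right_pos powr_gt_zero less_irrefl)
    then have "(Z powr (\<beta> / \<alpha>)) powr (\<alpha> / \<beta>) \<le> K powr (\<alpha> / \<beta>)"
      using assms(2,4) by (intro powr_mono2) auto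
    then show ?thesis using Z assms(2,4) by (simp add: powr_powr Z_def)
  qed (simp add: Z_def)
qed

lemma sum_fibers:
  fixes h :: "'i \<Rightarrow> real"
  assumes "finite I" "finite S" "f ` I \<subseteq> S"
  shows "(\<Sum>a\<in>S. \<Sum>i\<in>{i\<in>I. f i = a}. h i) = (\<Sum>i\<in>I. h i)"
  using assms by (intro sum.group)

text \<open>All exponents are divided by the exponent of the inner sum, which is therefore \<open>1\<close> here.
  For \<open>f = g\<close> the claim is plain duality, as the weight is constant on each fibre; this gives the
  bound for the fibre sums \<open>U\<close> of \<open>w\<close> along \<open>g\<close>. For the fibre sums \<open>F\<close> along \<open>f\<close>, use
  \<open>(\<Sum>a. F a powr \<alpha>) = (\<Sum>i. w i * F (f i) powr (\<alpha> - 1))\<close> and write the summand as a geometric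
  mean of \<open>w i\<close> and \<open>w i * F (f i) powr (\<beta> - 1)\<close>. Summed along the fibres of \<open>g\<close> these give \<open>U\<close> and
  a quantity \<open>V\<close>, to which duality also applies, because Hoelder's inequality on the fibres of \<open>f\<close>
  reduces the weighted sums of \<open>V\<close> to the hypothesis for \<open>f\<close>.\<close>

lemma remove_weight:
  fixes w :: "'i \<Rightarrow> real" and f :: "'i \<Rightarrow> 'b" and g :: "'i \<Rightarrow> 'b"
  assumes fin: "finite I" "finite S" "f ` I \<subseteq> S" "g ` I \<subseteq> S"
    and ex: "0 < \<beta>" "0 < P" "0 < \<alpha>" "\<alpha> \<le> 1" "1 / \<alpha> = 1 / \<beta> - 1 / P"
    and w: "\<And>i. i \<in> I \<Longrightarrow> 0 \<le> w i" and K: "0 \<le> K"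
    and hf: "\<And>y. (\<And>b. 0 \<le> y b) \<Longrightarrow>
      (\<Sum>a\<in>S. (\<Sum>i\<in>{i\<in>I. f i = a}. w i * y (g i)) powr \<beta>) \<le> K * (\<Sum>b\<in>S. y b powr P) powr (\<beta> / P)"
    and hg: "\<And>y. (\<And>b. 0 \<le> y b) \<Longrightarrow>
      (\<Sum>a\<in>S. (\<Sum>i\<in>{i\<in>I. g i = a}. w i * y (g i)) powr \<beta>) \<le> K * (\<Sum>b\<in>S. y b powr P) powr (\<beta> / P)"
  shows "(\<Sum>a\<in>S. (\<Sum>i\<in>{i\<in>I. f i = a}. w i) powr \<alpha>) \<le> K powr (\<alpha> / \<beta>)"
proof -
  define F where "F a = (\<Sum>i\<in>{i\<in>I. f i = a}. w i)" for a
  define U where "U b = (\<Sum>i\<in>{i\<in>I. g i = b}. w i)" for b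
  define V where "V b = (\<Sum>i\<in>{i\<in>I. g i = b}. w i * F (f i) powr (\<beta> - 1))" for b
  have "1 / \<alpha> < 1 / \<beta>" using ex by simp
  then have "\<beta> < \<alpha>" using ex(3) by (simp only: inverse_eq_divide[symmetric] inverse_less_imp_less)
  then have b1: "\<beta> < 1" using ex by simp
  have F0: "0 \<le> F a" for a unfolding F_def using w by (intro sum_nonneg) auto
  have U0: "0 \<le> U a" for a unfolding U_def using w by (intro sum_nonneg) auto
  have V0: "0 \<le> V a" for a unfolding V_def using w by (intro sum_nonneg) auto
  have wF: "w i = 0" if "i \<in> I" "F (f i) = 0" for i
    using that fin(1) w unfolding F_def by (subst (asm) sum_nonneg_eq_0_iff) auto
  have U: "(\<Sum>b\<in>S. U b powr \<alpha>) \<le> K powr (\<alpha> / \<beta>)"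
  proof (rule sum_powr_le_by_duality[OF fin(2) ex(1-3,5) U0 K])
    fix y :: "'b \<Rightarrow> real" assume y: "\<And>b. 0 \<le> y b"
    have *: "(\<Sum>i\<in>{i\<in>I. g i = b}. w i * y (g i)) powr \<beta> = U b powr \<beta> * y b powr \<beta>" for b
    proof -
      have "(\<Sum>i\<in>{i\<in>I. g i = b}. w i * y (g i)) = U b * y b"
        by (simp add: U_def sum_distrib_right)
      then show ?thesis using U0 y by (simp add: powr_mult)
    qed
    then show "(\<Sum>b\<in>S. U b powr \<beta> * y b powr \<beta>) \<le> K * (\<Sum>b\<in>S. y b powr P) powr (\<beta> / P)"
      using hg[of y] y by (simp only: *)
  qed
  have V: "(\<Sum>b\<in>S. V b powr (\<alpha> / \<beta>)) \<le> K powr (\<alpha> / \<beta>)"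
  proof -
    have "(\<Sum>b\<in>S. (V b powr (1 / \<beta>)) powr \<alpha>) \<le> K powr (\<alpha> / \<beta>)"
    proof (rule sum_powr_le_by_duality[OF fin(2) ex(1-3,5) _ K])
      fix y :: "'b \<Rightarrow> real" assume y: "\<And>b. 0 \<le> y b"
      have "(\<Sum>b\<in>S. (V b powr (1 / \<beta>)) powr \<beta> * y b powr \<beta>)
          = (\<Sum>b\<in>S. \<Sum>i\<in>{i\<in>I. g i = b}. w i * F (f i) powr (\<beta> - 1) * y (g i) powr \<beta>)"
        using ex(1) V0 by (simp add: powr_powr) (simp add: V_def sum_distrib_right)
      also have "\<dots> = (\<Sum>i\<in>I. w i * F (f i) powr (\<beta> - 1) * y (g i) powr \<beta>)"
        using fin by (intro sum_fibers)
      also have "\<dots> = (\<Sum>a\<in>S. \<Sum>i\<in>{i\<in>I. f i = a}. w i * F (f i) powr (\<beta> - 1) * y (g i) powr \<beta>)"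
        using fin by (intro sum_fibers[symmetric])
      also have "\<dots> \<le> (\<Sum>a\<in>S. (\<Sum>i\<in>{i\<in>I. f i = a}. w i * y (g i)) powr \<beta>)"
      proof (rule sum_mono)
        fix a assume "a \<in> S"
        let ?J = "{i\<in>I. f i = a}"
        show "(\<Sum>i\<in>?J. w i * F (f i) powr (\<beta> - 1) * y (g i) powr \<beta>) \<le> (\<Sum>i\<in>?J. w i * y (g i)) powr \<beta>"
        proof (cases "F a = 0")
          case True
          then show ?thesis using wF by (simp add: sum_nonneg)
        next
          case False
          then have Fa: "F a > 0" using F0[of a] by simp
          have "(\<Sum>i\<in>?J. w i * F (f i) powr (\<beta> - 1) * y (g i) powr \<beta>)
              = F a powr (\<beta> - 1) * (\<Sum>i\<in>?J. (w i * y (g i)) powr \<beta> * w i powr (1 - \<beta>))"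
            unfolding sum_distrib_left
          proof (intro sum.cong refl)
            fix i assume i: "i \<in> ?J"
            have "w i = w i powr \<beta> * w i powr (1 - \<beta>)"
              using w i by (simp add: powr_add[symmetric])
            then show "w i * F (f i) powr (\<beta> - 1) * y (g i) powr \<beta>
                = F a powr (\<beta> - 1) * ((w i * y (g i)) powr \<beta> * w i powr (1 - \<beta>))"
              using i w y by (simp add: powr_mult)
          qed
          also have "\<dots> \<le> F a powr (\<beta> - 1)
              * ((\<Sum>i\<in>?J. w i * y (g i)) powr \<beta> * (\<Sum>i\<in>?J. w i) powr (1 - \<beta>))"
            using fin w y ex(1) b1 by (intro mult_left_mono holder_two) auto
          also have "\<dots> = (\<Sum>i\<in>?J. w i * y (g i)) powr \<beta> * (F a powr (\<beta> - 1) * F a powr (1 - \<beta>))"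
            by (simp add: F_def)
          also have "F a powr (\<beta> - 1) * F a powr (1 - \<beta>) = 1"
            using Fa by (simp add: powr_add[symmetric])
          finally show ?thesis by simp
        qed
      qed
      also have "\<dots> \<le> K * (\<Sum>b\<in>S. y b powr P) powr (\<beta> / P)" by (rule hf[OF y])
      finally show "(\<Sum>b\<in>S. (V b powr (1 / \<beta>)) powr \<beta> * y b powr \<beta>)
          \<le> K * (\<Sum>b\<in>S. y b powr P) powr (\<beta> / P)" .
    qed simp
    then show ?thesis by (simp add: powr_powr)
  qed
  \<comment> \<open>the exponent with \<open>F powr (\<alpha> - 1) = (F powr (\<beta> - 1)) powr \<theta>\<close>\<close>
  define \<theta> where "\<theta> = (1 - \<alpha>) / (1 - \<beta>)"
  have \<theta>: "0 \<le> \<theta>" "0 \<le> 1 - \<theta>" "\<theta> * (1 - \<beta>) = 1 - \<alpha>"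
    using ex b1 \<open>\<beta> < \<alpha>\<close> by (auto simp: \<theta>_def field_simps)
  have s1: "(1 - \<theta>) / \<alpha> + \<theta> * \<beta> / \<alpha> = 1"
  proof -
    have "(1 - \<theta>) + \<theta> * \<beta> = \<alpha>" using \<theta>(3) by (simp add: algebra_simps)
    then show ?thesis using ex(3) by (simp add: add_divide_distrib[symmetric])
  qed
  have "(\<Sum>a\<in>S. F a powr \<alpha>) = (\<Sum>a\<in>S. \<Sum>i\<in>{i\<in>I. f i = a}. w i * F (f i) powr (\<alpha> - 1))"
  proof (intro sum.cong refl)
    fix a
    have "(\<Sum>i\<in>{i\<in>I. f i = a}. w i * F (f i) powr (\<alpha> - 1)) = F a * F a powr (\<alpha> - 1)"
      by (simp add: F_def sum_distrib_right)
    then show "F a powr \<alpha> = (\<Sum>i\<in>{i\<in>I. f i = a}. w i * F (f i) powr (\<alpha> - 1))"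
      using F0 by (simp add: powr_mult_base)
  qed
  also have "\<dots> = (\<Sum>i\<in>I. w i * F (f i) powr (\<alpha> - 1))"
    using fin by (intro sum_fibers)
  also have "\<dots> = (\<Sum>b\<in>S. \<Sum>i\<in>{i\<in>I. g i = b}. w i * F (f i) powr (\<alpha> - 1))"
    using fin by (intro sum_fibers[symmetric])
  also have "\<dots> \<le> (\<Sum>b\<in>S. (U b powr \<alpha>) powr ((1 - \<theta>) / \<alpha>) * (V b powr (\<alpha> / \<beta>)) powr (\<theta> * \<beta> / \<alpha>))"
  proof (rule sum_mono)
    fix b
    let ?J = "{i\<in>I. g i = b}"
    have "(\<Sum>i\<in>?J. w i * F (f i) powr (\<alpha> - 1))
        = (\<Sum>i\<in>?J. w i powr (1 - \<theta>) * (w i * F (f i) powr (\<beta> - 1)) powr \<theta>)"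
    proof (intro sum.cong refl)
      fix i assume i: "i \<in> ?J"
      have "(\<beta> - 1) * \<theta> = \<alpha> - 1" using \<theta>(3) by (simp add: algebra_simps)
      moreover have "w i = w i powr (1 - \<theta>) * w i powr \<theta>"
        using w i by (simp add: powr_add[symmetric])
      ultimately show "w i * F (f i) powr (\<alpha> - 1)
          = w i powr (1 - \<theta>) * (w i * F (f i) powr (\<beta> - 1)) powr \<theta>"
        using i w by (simp add: powr_mult powr_powr)
    qed
    also have "\<dots> \<le> U b powr (1 - \<theta>) * V b powr \<theta>"
      unfolding U_def V_def using fin w \<theta> by (intro holder_two) auto
    also have "\<dots> = (U b powr \<alpha>) powr ((1 - \<theta>) / \<alpha>) * (V b powr (\<alpha> / \<beta>)) powr (\<theta> * \<beta> / \<alpha>)"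
      using ex by (simp add: powr_powr)
    finally show "(\<Sum>i\<in>?J. w i * F (f i) powr (\<alpha> - 1))
        \<le> (U b powr \<alpha>) powr ((1 - \<theta>) / \<alpha>) * (V b powr (\<alpha> / \<beta>)) powr (\<theta> * \<beta> / \<alpha>)" .
  qed
  also have "\<dots> \<le> (\<Sum>b\<in>S. U b powr \<alpha>) powr ((1 - \<theta>) / \<alpha>) * (\<Sum>b\<in>S. V b powr (\<alpha> / \<beta>)) powr (\<theta> * \<beta> / \<alpha>)"
    using fin ex \<theta> s1 by (intro holder_two) auto
  also have "\<dots> \<le> (K powr (\<alpha> / \<beta>)) powr ((1 - \<theta>) / \<alpha>) * (K powr (\<alpha> / \<beta>)) powr (\<theta> * \<beta> / \<alpha>)"
    using U V ex \<theta> by (intro mult_mono powr_mono2) (auto intro: sum_nonneg)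
  also have "\<dots> = K powr (\<alpha> / \<beta>)"
    using s1 by (simp add: powr_add[symmetric])
  finally show ?thesis by (simp add: F_def)
qed

text \<open>Removing the weight in coordinate \<open>j\<close> while the others are fixed turns the hypothesis for
  \<open>insert j J\<close> into the one for \<open>J\<close>, with \<open>1 / \<beta>\<close> lowered by \<open>1 / P j\<close>. The hypothesis is needed for
  every \<open>k \<in> M\<close> at once, since \<open>remove_weight\<close> for the coordinate \<open>k\<close> uses the sums along
  the coordinate \<open>j\<close> too.\<close>

lemma remove_weights:
  fixes w :: "'i \<Rightarrow> real" and \<pi> :: "'j \<Rightarrow> 'i \<Rightarrow> 'b"
  assumes "finite J" "J \<subseteq> M" and fin: "finite I" "finite S" "\<And>k. k \<in> M \<Longrightarrow> \<pi> k ` I \<subseteq> S"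
    and "0 < \<beta>" "\<And>j. j \<in> J \<Longrightarrow> 0 < P j" and \<alpha>: "0 < \<alpha>" "\<alpha> \<le> 1"
    and "1 / \<alpha> = 1 / \<beta> - (\<Sum>j\<in>J. 1 / P j)"
    and w: "\<And>i. i \<in> I \<Longrightarrow> 0 \<le> w i" and "0 \<le> K"
    and "\<And>k y. k \<in> M \<Longrightarrow> (\<And>j b. 0 \<le> y j b) \<Longrightarrow>
      (\<Sum>a\<in>S. (\<Sum>i\<in>{i\<in>I. \<pi> k i = a}. w i * (\<Prod>j\<in>J. y j (\<pi> j i))) powr \<beta>)
        \<le> K * (\<Prod>j\<in>J. (\<Sum>b\<in>S. y j b powr P j) powr (\<beta> / P j))"
    and "k \<in> M"
  shows "(\<Sum>a\<in>S. (\<Sum>i\<in>{i\<in>I. \<pi> k i = a}. w i) powr \<alpha>) \<le> K powr (\<alpha> / \<beta>)"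
  using assms(1,2,6,7,10,12-14)
proof (induction J arbitrary: K \<beta> k)
  case empty
  then have "\<alpha> = \<beta>" by simp
  then show ?case using empty.prems(6)[of k "\<lambda>_ _. 0"] empty.prems \<alpha>(1) by simp
next
  case (insert j J)
  \<comment> \<open>the outer exponent once the weight in coordinate \<open>j\<close> is removed\<close>
  define \<gamma> where "\<gamma> = inverse (1 / \<beta> - 1 / P j)"
  have "1 / \<beta> - 1 / P j = 1 / \<alpha> + (\<Sum>j\<in>J. 1 / P j)"
    using insert.prems(4) insert.hyps by simp
  moreover have s0: "0 \<le> (\<Sum>j\<in>J. 1 / P j)"
    using insert.prems(3) by (intro sum_nonneg) (simp add: less_imp_le)
  ultimately have g1: "1 / \<gamma> = 1 / \<beta> - 1 / P j" "1 / \<alpha> = 1 / \<gamma> - (\<Sum>j\<in>J. 1 / P j)"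
    by (simp_all add: \<gamma>_def divide_inverse)
  have "1 / \<gamma> \<ge> 1 / \<alpha>" using g1 s0 by simp
  moreover have "1 / \<alpha> > 0" using \<alpha> by simp
  ultimately have g0: "0 < \<gamma>" by (metis less_le_trans zero_less_divide_1_iff)
  have "\<gamma> \<le> \<alpha>" using \<open>1 / \<gamma> \<ge> 1 / \<alpha>\<close> g0 \<alpha> by (simp add: field_simps)
  then have g2: "\<gamma> \<le> 1" using \<alpha> by simp
  have P: "0 < P l" if "l \<in> J" for l using insert.prems(3) that by simp
  have "(\<Sum>a\<in>S. (\<Sum>i\<in>{i\<in>I. \<pi> k i = a}. w i) powr \<alpha>) \<le> (K powr (\<gamma> / \<beta>)) powr (\<alpha> / \<gamma>)"
  proof (rule insert.IH[OF _ g0 P g1(2)])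
    fix k and y :: "'j \<Rightarrow> 'b \<Rightarrow> real" assume k: "k \<in> M" and y: "\<And>j b. 0 \<le> y j b"
    define Y where "Y i = (\<Prod>l\<in>J. y l (\<pi> l i))" for i
    define N where "N = (\<Prod>l\<in>J. (\<Sum>b\<in>S. y l b powr P l) powr (\<beta> / P l))"
    have N0: "0 \<le> N" unfolding N_def by (intro prod_nonneg) auto
    have *: "(\<Sum>a\<in>S. (\<Sum>i\<in>{i\<in>I. \<pi> k i = a}. (w i * Y i) * x (\<pi> j i)) powr \<beta>)
        \<le> (K * N) * (\<Sum>b\<in>S. x b powr P j) powr (\<beta> / P j)"
      if k: "k \<in> M" and x: "\<And>b. 0 \<le> x b" for k and x :: "'b \<Rightarrow> real"
    proof -
      have "(\<Prod>l\<in>insert j J. (y(j := x)) l (\<pi> l i)) = x (\<pi> j i) * Y i" for i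
      proof -
        have "(\<Prod>l\<in>J. (y(j := x)) l (\<pi> l i)) = Y i"
          unfolding Y_def using insert.hyps by (intro prod.cong) auto
        then show ?thesis using insert.hyps by simp
      qed
      moreover have "(\<Prod>l\<in>insert j J. (\<Sum>b\<in>S. (y(j := x)) l b powr P l) powr (\<beta> / P l))
          = (\<Sum>b\<in>S. x b powr P j) powr (\<beta> / P j) * N"
      proof -
        have "(\<Prod>l\<in>J. (\<Sum>b\<in>S. (y(j := x)) l b powr P l) powr (\<beta> / P l)) = N"
          unfolding N_def using insert.hyps by (intro prod.cong) auto
        then show ?thesis using insert.hyps by simp
      qed
      moreover have "0 \<le> (y(j := x)) l b" for l b using x y by simp
      ultimately show ?thesis
        using insert.prems(6)[OF k, of "y(j := x)"] by (simp only: ac_simps)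
    qed
    have "(\<Sum>a\<in>S. (\<Sum>i\<in>{i\<in>I. \<pi> k i = a}. w i * Y i) powr \<gamma>) \<le> (K * N) powr (\<gamma> / \<beta>)"
    proof (rule remove_weight[where f = "\<pi> k" and g = "\<pi> j" and P = "P j"])
      show "0 \<le> w i * Y i" if "i \<in> I" for i
        using w that y unfolding Y_def by (intro mult_nonneg_nonneg prod_nonneg) auto
      show "0 \<le> K * N" using insert.prems N0 by simp
      have "(\<Sum>a\<in>S. (\<Sum>i\<in>{i\<in>I. \<pi> l i = a}. w i * Y i * x (\<pi> j i)) powr \<beta>)
          \<le> K * N * (\<Sum>b\<in>S. x b powr P j) powr (\<beta> / P j)"
        if "\<And>b. 0 \<le> x b" "l = k \<or> l = j" for x l
        using that k insert.prems(1) by (intro *) auto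
      then show "(\<Sum>a\<in>S. (\<Sum>i\<in>{i\<in>I. \<pi> k i = a}. w i * Y i * x (\<pi> j i)) powr \<beta>)
          \<le> K * N * (\<Sum>b\<in>S. x b powr P j) powr (\<beta> / P j)"
        "(\<Sum>a\<in>S. (\<Sum>i\<in>{i\<in>I. \<pi> j i = a}. w i * Y i * x (\<pi> j i)) powr \<beta>)
          \<le> K * N * (\<Sum>b\<in>S. x b powr P j) powr (\<beta> / P j)"
        if "\<And>b. 0 \<le> x b" for x using that by blast+
    qed (use fin k insert.prems g0 g1 g2 in auto)
    also have "\<dots> = K powr (\<gamma> / \<beta>) * (\<Prod>l\<in>J. (\<Sum>b\<in>S. y l b powr P l) powr (\<gamma> / P l))"
      using insert.prems(2,5) N0
      by (simp add: powr_mult) (simp add: N_def powr_powr prod_powr_distrib)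
    finally show "(\<Sum>a\<in>S. (\<Sum>i\<in>{i\<in>I. \<pi> k i = a}. w i * (\<Prod>l\<in>J. y l (\<pi> l i))) powr \<gamma>)
        \<le> K powr (\<gamma> / \<beta>) * (\<Prod>l\<in>J. (\<Sum>b\<in>S. y l b powr P l) powr (\<gamma> / P l))"
      by (simp add: Y_def)
  qed (use insert.prems in auto)
  also have "\<dots> = K powr (\<alpha> / \<beta>)"
    using g0 by (simp add: powr_powr)
  finally show ?case .
qed

section \<open>Interpolation of mixed sums\<close>

text \<open>With \<open>F k\<close> the fibre sums of \<open>w\<close> along the coordinate \<open>k\<close>, two quantities have controlled sums over
  \<open>i\<close>: \<open>w i * F k (i k) powr (\<alpha> - 1)\<close>, with sum \<open>\<Sum>a\<in>S. F k a powr \<alpha>\<close>, and the product of all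
  \<open>F k (i k) powr \<alpha>\<close>, with sum the product of those sums. The power \<open>w i powr \<nu>\<close> is
  a geometric mean of them, so Hoelder's inequality applies. The value \<open>None\<close> indexes the product.\<close>

lemma blei:
  fixes w :: "('j \<Rightarrow> 'b) \<Rightarrow> real" and \<alpha> \<nu> K :: real
  assumes M: "finite M" "M \<noteq> {}" and S: "finite S"
    and \<alpha>: "0 < \<alpha>" "\<alpha> \<le> 1" and \<nu>: "1 / \<nu> = 1 / (real (card M) * \<alpha>) + (real (card M) - 1) / real (card M)"
    and w: "\<And>i. i \<in> PiE M (\<lambda>_. S) \<Longrightarrow> 0 \<le> w i"
    and K: "0 \<le> K" "\<And>k. k \<in> M \<Longrightarrow> (\<Sum>a\<in>S. (\<Sum>i\<in>{i \<in> PiE M (\<lambda>_. S). i k = a}. w i) powr \<alpha>) \<le> K"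
  shows "(\<Sum>i\<in>PiE M (\<lambda>_. S). w i powr \<nu>) \<le> K powr (\<nu> / \<alpha>)"
proof -
  let ?I = "PiE M (\<lambda>_. S)" and ?m = "real (card M)"
  have m: "?m \<ge> 1" using M by (simp add: card_gt_0_iff Suc_leI)
  have fin: "finite ?I" using M S by (intro finite_PiE) auto
  define F where "F k a = (\<Sum>i\<in>{i \<in> ?I. i k = a}. w i)" for k a
  have F0: "0 \<le> F k a" for k a unfolding F_def using w by (intro sum_nonneg) auto
  have wF: "w i \<le> F k (i k)" if "i \<in> ?I" for i k
    unfolding F_def using that fin w by (intro member_le_sum) auto
  have "1 / \<nu> > 0" using \<alpha> m unfolding \<nu> by (intro add_pos_nonneg) auto
  then have \<nu>0: "\<nu> > 0" by simp
  \<comment> \<open>In the product of all factors, \<open>\<theta>\<close> produces \<open>w i powr \<nu>\<close> and \<open>\<eta>\<close> cancels the powers of \<open>F\<close>.\<close>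
  define \<theta> where "\<theta> = \<nu> / ?m"
  define \<eta> where "\<eta> = \<theta> * (1 - \<alpha>) / \<alpha>"
  have th: "0 \<le> \<theta>" "0 \<le> \<eta>" using \<nu>0 m \<alpha> by (auto simp: \<theta>_def \<eta>_def)
  have th1: "?m * \<theta> + \<eta> = 1"
  proof -
    have "1 / \<nu> = 1 + (1 - \<alpha>) / (?m * \<alpha>)"
      using \<nu> m \<alpha> by (simp add: field_simps)
    then have "\<nu> * (1 + (1 - \<alpha>) / (?m * \<alpha>)) = 1" using \<nu>0 by (metis less_irrefl nonzero_mult_div_cancel_left times_divide_eq_right mult.right_neutral)
    then show ?thesis using m \<alpha> by (simp add: \<theta>_def \<eta>_def field_simps)
  qed
  define u where "u k i = (case k of Some k \<Rightarrow> w i * F k (i k) powr (\<alpha> - 1)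
    | None \<Rightarrow> (\<Prod>k\<in>M. F k (i k) powr \<alpha>))" for k i
  define \<rho> where "\<rho> k = (if k = None then \<eta> else \<theta>)" for k :: "'j option"
  let ?N = "insert None (Some ` M)"
  have prodN: "(\<Prod>k\<in>?N. h k) = h None * (\<Prod>k\<in>M. h (Some k))" for h :: "'j option \<Rightarrow> real"
    using M by (subst prod.insert) (auto simp: prod.reindex)
  have sumN: "(\<Sum>k\<in>?N. h k) = h None + (\<Sum>k\<in>M. h (Some k))" for h :: "'j option \<Rightarrow> real"
    using M by (subst sum.insert) (auto simp: sum.reindex)
  have u0: "0 \<le> u k i" if "i \<in> ?I" for k i
    using w that by (cases k) (auto simp: u_def intro!: prod_nonneg)
  have "(\<Sum>i\<in>?I. w i powr \<nu>) \<le> (\<Sum>i\<in>?I. \<Prod>k\<in>?N. u k i powr \<rho> k)"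
  proof (rule sum_mono)
    fix i assume i: "i \<in> ?I"
    show "w i powr \<nu> \<le> (\<Prod>k\<in>?N. u k i powr \<rho> k)"
    proof (cases "w i = 0")
      case True
      then show ?thesis using u0[OF i] \<nu>0 by (simp add: prod_nonneg)
    next
      case False
      then have wi: "w i > 0" using w[OF i] by simp
      then have Fi: "F k (i k) > 0" for k using wF[OF i, of k] by simp
      have "(\<Prod>k\<in>?N. u k i powr \<rho> k)
          = (\<Prod>k\<in>M. (F k (i k) powr \<alpha>) powr \<eta> * (w i * F k (i k) powr (\<alpha> - 1)) powr \<theta>)"
        unfolding prodN by (simp add: u_def \<rho>_def prod.distrib prod_powr_distrib)
      also have "\<dots> = (\<Prod>k\<in>M. w i powr \<theta>)"
      proof (intro prod.cong refl)
        fix k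
        have "\<alpha> * \<eta> + (\<alpha> - 1) * \<theta> = 0" using \<alpha> by (simp add: \<eta>_def field_simps)
        then have "(F k (i k) powr \<alpha>) powr \<eta> * (F k (i k) powr (\<alpha> - 1)) powr \<theta> = 1"
          using Fi[of k] by (simp only: powr_powr powr_add[symmetric]) simp
        then show "(F k (i k) powr \<alpha>) powr \<eta> * (w i * F k (i k) powr (\<alpha> - 1)) powr \<theta> = w i powr \<theta>"
          using wi by (simp add: powr_mult mult.left_commute)
      qed
      also have "\<dots> = w i powr \<nu>"
        using wi m by (simp add: powr_power \<theta>_def)
      finally show ?thesis by simp
    qed
  qed
  also have "\<dots> \<le> (\<Prod>k\<in>?N. (\<Sum>i\<in>?I. u k i) powr \<rho> k)"
  proof (rule holder_prod)
    show "sum \<rho> ?N = 1" unfolding sumN using th1 by (simp add: \<rho>_def)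
  qed (use fin M u0 th in \<open>auto simp: \<rho>_def\<close>)
  also have "\<dots> \<le> (K ^ card M) powr \<eta> * (\<Prod>k\<in>M. K powr \<theta>)"
    unfolding prodN
  proof (intro mult_mono prod_mono conjI)
    have "(\<Sum>i\<in>?I. u None i) = (\<Prod>k\<in>M. \<Sum>a\<in>S. F k a powr \<alpha>)"
      unfolding u_def using M S by (simp add: prod_sum_PiE)
    also have "\<dots> \<le> (\<Prod>k\<in>M. K)"
      using K(2) by (intro prod_mono) (auto simp: F_def sum_nonneg)
    finally show "(\<Sum>i\<in>?I. u None i) powr \<rho> None \<le> (K ^ card M) powr \<eta>"
      using th u0 by (simp add: \<rho>_def powr_mono2 sum_nonneg)
    fix k assume k: "k \<in> M"
    have "(\<Sum>i\<in>?I. u (Some k) i) = (\<Sum>a\<in>S. \<Sum>i\<in>{i\<in>?I. i k = a}. u (Some k) i)"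
      using k fin S by (intro sum_fibers[symmetric]) auto
    also have "\<dots> = (\<Sum>a\<in>S. F k a powr \<alpha>)"
    proof (intro sum.cong refl)
      fix a
      have "(\<Sum>i\<in>{i\<in>?I. i k = a}. u (Some k) i) = F k a * F k a powr (\<alpha> - 1)"
        by (simp add: u_def F_def sum_distrib_right)
      then show "(\<Sum>i\<in>{i\<in>?I. i k = a}. u (Some k) i) = F k a powr \<alpha>"
        using F0 by (simp add: powr_mult_base)
    qed
    also have "\<dots> \<le> K" using K(2)[OF k] by (simp add: F_def)
    finally show "(\<Sum>i\<in>?I. u (Some k) i) powr \<rho> (Some k) \<le> K powr \<theta>"
      using th u0 by (simp add: \<rho>_def powr_mono2 sum_nonneg)
  qed (auto intro: prod_nonneg)
  also have "\<dots> = K powr (\<nu> / \<alpha>)"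
  proof (cases "K = 0")
    case True then show ?thesis using M by (simp add: power_0_left)
  next
    case False
    then have "K > 0" using K(1) by simp
    then have "(K ^ card M) powr \<eta> * (\<Prod>k\<in>M. K powr \<theta>) = K powr (?m * \<eta> + ?m * \<theta>)"
      by (simp add: powr_realpow[symmetric] powr_powr powr_add[symmetric] mult.commute)
    also have "?m * \<eta> + ?m * \<theta> = \<nu> / \<alpha>"
      using m \<alpha> by (simp add: \<eta>_def \<theta>_def field_simps)
    finally show ?thesis .
  qed
  finally show ?thesis .
qed

section \<open>Multilinear mappings on finitely supported sequences\<close>

lemma scaleC_zero_left: "0 *\<^sub>C x = (0 :: 'a::complex_normed_vector)"
  using scaleR_scaleC[of 0 x] by simp

lemma scaleC_one: "1 *\<^sub>C x = (x :: 'a::complex_normed_vector)"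
  using scaleR_scaleC[of 1 x] by simp

lemma lp_scale:
  assumes "1 \<le> p" "x \<in> lp_space p"
  shows "(\<lambda>n. c * x n) \<in> lp_space p" and "lp_norm p (\<lambda>n. c * x n) \<le> cmod c * lp_norm p x"
proof -
  have "(\<lambda>n. c * x n) \<in> lp_space p \<and> lp_norm p (\<lambda>n. c * x n) \<le> cmod c * lp_norm p x"
  proof (cases "p = \<infinity>")
    case True
    then have bdd: "bdd_above (range (\<lambda>i. cmod (x i)))" using assms(2) by (simp add: lp_space_def)
    have le: "cmod (c * x i) \<le> cmod c * (SUP i. cmod (x i))" for i
      using cSUP_upper[OF _ bdd, of i] by (simp add: norm_mult mult_left_mono)
    then show ?thesis using True
      by (auto simp: lp_space_def lp_norm_def intro!: bdd_aboveI2 cSUP_least)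
  next
    case False
    define P where "P = real_of_ereal p"
    have P: "1 \<le> P" using assms(1) False by (cases p) (auto simp: P_def)
    have s: "summable (\<lambda>i. cmod (x i) powr P)" using assms(2) False by (simp add: lp_space_def P_def)
    have "(\<Sum>i. cmod c powr P * cmod (x i) powr P) = cmod c powr P * (\<Sum>i. cmod (x i) powr P)"
      by (rule suminf_mult[OF s])
    then show ?thesis using False P suminf_nonneg[OF s] summable_mult[OF s, of "cmod c powr P"]
      by (simp add: lp_space_def lp_norm_def P_def[symmetric] norm_mult powr_mult powr_powr)
  qed
  then show "(\<lambda>n. c * x n) \<in> lp_space p" and "lp_norm p (\<lambda>n. c * x n) \<le> cmod c * lp_norm p x"
    by auto
qed

definition truncate :: "nat \<Rightarrow> (nat \<Rightarrow> complex) \<Rightarrow> nat \<Rightarrow> complex"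
  where "truncate n c = (\<lambda>b. if b < n then c b else 0)"

lemma truncate_in_lp: "truncate n c \<in> lp_space p"
proof -
  have "bdd_above (range (\<lambda>i. cmod (truncate n c i)))"
  proof (rule bdd_aboveI2)
    show "cmod (truncate n c i) \<le> (\<Sum>b<n. cmod (c b))" for i
      by (auto simp: truncate_def intro!: member_le_sum sum_nonneg)
  qed
  moreover have "summable (\<lambda>i. cmod (truncate n c i) powr s)" for s
    by (rule summable_finite[of "{..<n}"]) (auto simp: truncate_def)
  ultimately show ?thesis by (simp add: lp_space_def)
qed

lemma lp_norm_truncate:
  assumes "p \<noteq> \<infinity>"
  shows "lp_norm p (truncate n c)
    = (\<Sum>b<n. cmod (c b) powr real_of_ereal p) powr (1 / real_of_ereal p)"
proof -
  have "(\<Sum>i. cmod (truncate n c i) powr real_of_ereal p) = (\<Sum>b<n. cmod (truncate n c b) powr real_of_ereal p)"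
    by (rule suminf_finite) (auto simp: truncate_def)
  then show ?thesis using assms by (simp add: lp_norm_def truncate_def)
qed

lemma lp_norm_truncate_infinity:
  assumes "\<And>b. cmod (c b) \<le> 1"
  shows "lp_norm \<infinity> (truncate n c) \<le> 1"
  using assms by (auto simp: lp_norm_def truncate_def intro!: cSUP_least)

lemma unit_vec_in_lp: "unit_vec b \<in> lp_space p"
proof -
  have "unit_vec b = truncate (Suc b) (unit_vec b)" by (auto simp: unit_vec_def truncate_def)
  then show ?thesis by (metis truncate_in_lp)
qed

lemma zero_in_lp: "(\<lambda>_. 0) \<in> lp_space p"
  using truncate_in_lp[of 0 _ p] by (simp add: truncate_def)

lemma lp_norm_zero: "1 \<le> p \<Longrightarrow> lp_norm p (\<lambda>_. 0) = 0"
  by (simp add: lp_norm_def)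

lemma lp_prod_mem: "x \<in> lp_prod m p \<Longrightarrow> j < m \<Longrightarrow> x j \<in> lp_space (p j)"
  unfolding lp_prod_def by (auto dest: PiE_mem)

lemma lp_prod_if:
  assumes "x \<in> lp_prod m p" "J \<subseteq> {..<m}" "\<And>j. j \<in> J \<Longrightarrow> y j \<in> lp_space (p j)"
  shows "(\<lambda>j. if j \<in> J then y j else x j) \<in> lp_prod m p"
  using assms unfolding lp_prod_def PiE_iff extensional_def by auto

lemma zero_in_lp_prod: "restrict (\<lambda>_ _. 0) {..<m} \<in> lp_prod m p"
  unfolding lp_prod_def using zero_in_lp by auto

context
  fixes m :: nat and p :: "nat \<Rightarrow> ereal"
    and T :: "(nat \<Rightarrow> nat \<Rightarrow> complex) \<Rightarrow> 'x::complex_banach"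
  assumes p: "\<forall>j<m. 1 \<le> p j" and T: "multilinear_map m p T"
begin

lemma T_scale:
  "x \<in> lp_prod m p \<Longrightarrow> j < m \<Longrightarrow> y \<in> lp_space (p j) \<Longrightarrow> T (x(j := (\<lambda>n. c * y n))) = c *\<^sub>C T (x(j := y))"
  using T unfolding multilinear_map_def by blast

lemma T_add:
  "x \<in> lp_prod m p \<Longrightarrow> j < m \<Longrightarrow> y \<in> lp_space (p j) \<Longrightarrow> z \<in> lp_space (p j) \<Longrightarrow>
    T (x(j := (\<lambda>n. y n + z n))) = T (x(j := y)) + T (x(j := z))"
  using T unfolding multilinear_map_def by blast

text \<open>The set \<open>J\<close> of coordinates treated so far carries the induction, here and in \<open>T_expand_on\<close>.\<close>

lemma T_scale_all:
  assumes "J \<subseteq> {..<m}" "x \<in> lp_prod m p"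
  shows "T (\<lambda>j. if j \<in> J then (\<lambda>n. s j * x j n) else x j) = (\<Prod>j\<in>J. s j) *\<^sub>C T x"
proof -
  have "finite J" using assms(1) finite_subset by blast
  then show ?thesis using assms(1)
  proof (induction J)
    case empty
    then show ?case by (simp add: scaleC_one)
  next
    case (insert j J)
    define z where "z = (\<lambda>j. if j \<in> J then (\<lambda>n. s j * x j n) else x j)"
    have z: "z \<in> lp_prod m p" unfolding z_def
      using insert.prems assms(2) p by (intro lp_prod_if lp_scale lp_prod_mem) auto
    have "(\<lambda>l. if l \<in> insert j J then (\<lambda>n. s l * x l n) else x l) = z(j := (\<lambda>n. s j * x j n))"
      using insert.hyps by (auto simp: z_def)
    then have "T (\<lambda>l. if l \<in> insert j J then (\<lambda>n. s l * x l n) else x l) = s j *\<^sub>C T (z(j := x j))"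
      using T_scale[OF z, of j "x j" "s j"] lp_prod_mem[OF assms(2), of j] insert.prems by simp
    also have "z(j := x j) = z" using insert.hyps by (auto simp: z_def)
    also have "T z = (\<Prod>j\<in>J. s j) *\<^sub>C T x" using insert by (simp add: z_def)
    finally show ?case using insert.hyps by (simp add: scaleC_scaleC)
  qed
qed

lemma T_truncate:
  assumes "x \<in> lp_prod m p" "j < m"
  shows "T (x(j := truncate n c)) = (\<Sum>b<n. c b *\<^sub>C T (x(j := unit_vec b)))"
proof (induction n)
  case 0
  have "T (x(j := (\<lambda>n. 0 * (0::complex)))) = 0 *\<^sub>C T (x(j := (\<lambda>_. 0)))"
    using assms by (intro T_scale zero_in_lp)
  then show ?case by (simp add: truncate_def scaleC_zero_left fun_upd_def)
next
  case (Suc n)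
  have c: "(\<lambda>k. c n * unit_vec n k) \<in> lp_space (p j)"
    using p assms by (intro lp_scale unit_vec_in_lp) auto
  have "truncate (Suc n) c = (\<lambda>k. truncate n c k + c n * unit_vec n k)"
    by (rule ext) (auto simp: truncate_def unit_vec_def less_Suc_eq)
  then have "T (x(j := truncate (Suc n) c)) = T (x(j := truncate n c)) + T (x(j := (\<lambda>k. c n * unit_vec n k)))"
    using T_add[OF assms truncate_in_lp c] by simp
  then show ?case using Suc T_scale[OF assms unit_vec_in_lp] by (simp add: fun_upd_def)
qed

lemma T_expand_on:
  assumes "J \<subseteq> {..<m}" "x \<in> lp_prod m p"
  shows "T (\<lambda>j. if j \<in> J then truncate n (c j) else x j)
    = (\<Sum>i\<in>PiE J (\<lambda>_. {..<n}). (\<Prod>j\<in>J. c j (i j)) *\<^sub>C T (\<lambda>j. if j \<in> J then unit_vec (i j) else x j))"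
proof -
  have "finite J" using assms(1) finite_subset by blast
  then show ?thesis using assms
  proof (induction J arbitrary: x)
    case empty
    then show ?case by (simp add: scaleC_one)
  next
    case (insert j J)
    define w where "w i = (\<lambda>l. if l \<in> J then unit_vec (i l) else x l)" for i :: "nat \<Rightarrow> nat"
    have j: "j < m" "J \<subseteq> {..<m}" using insert.prems by auto
    have w: "w i \<in> lp_prod m p" for i
      unfolding w_def using insert.prems by (intro lp_prod_if unit_vec_in_lp) auto
    have x': "x(j := truncate n (c j)) \<in> lp_prod m p"
      using lp_prod_if[OF insert.prems(2), of "{j}" "\<lambda>_. truncate n (c j)"] j(1) truncate_in_lp
      by (simp add: fun_upd_def)
    have "(\<lambda>l. if l \<in> insert j J then truncate n (c l) else x l)
        = (\<lambda>l. if l \<in> J then truncate n (c l) else (x(j := truncate n (c j))) l)"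
      using insert.hyps by auto
    then have "T (\<lambda>l. if l \<in> insert j J then truncate n (c l) else x l)
      = (\<Sum>i\<in>PiE J (\<lambda>_. {..<n}). (\<Prod>j\<in>J. c j (i j)) *\<^sub>C
          T (\<lambda>l. if l \<in> J then unit_vec (i l) else (x(j := truncate n (c j))) l))"
      using insert.IH[OF j(2) x'] by simp
    also have "\<dots> = (\<Sum>i\<in>PiE J (\<lambda>_. {..<n}). (\<Prod>j\<in>J. c j (i j)) *\<^sub>C
          (\<Sum>b<n. c j b *\<^sub>C T ((w i)(j := unit_vec b))))"
    proof (intro sum.cong refl arg_cong2[where f = scaleC])
      fix i
      have "(\<lambda>l. if l \<in> J then unit_vec (i l) else (x(j := truncate n (c j))) l) = (w i)(j := truncate n (c j))"
        using insert.hyps by (auto simp: w_def)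
      then show "T (\<lambda>l. if l \<in> J then unit_vec (i l) else (x(j := truncate n (c j))) l)
          = (\<Sum>b<n. c j b *\<^sub>C T ((w i)(j := unit_vec b)))"
        using T_truncate[OF w j(1)] by simp
    qed
    also have "\<dots> = (\<Sum>b<n. \<Sum>i\<in>PiE J (\<lambda>_. {..<n}).
        (\<Prod>l\<in>insert j J. c l ((i(j := b)) l)) *\<^sub>C
          T (\<lambda>l. if l \<in> insert j J then unit_vec ((i(j := b)) l) else x l))"
      unfolding scaleC_sum_right
    proof (subst sum.swap, intro sum.cong refl)
      fix b i
      have "(\<Prod>l\<in>J. c l ((i(j := b)) l)) = (\<Prod>l\<in>J. c l (i l))"
        using insert.hyps by (intro prod.cong) auto
      moreover have "(w i)(j := unit_vec b) = (\<lambda>l. if l \<in> insert j J then unit_vec ((i(j := b)) l) else x l)"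
        by (auto simp: w_def)
      ultimately show "(\<Prod>j\<in>J. c j (i j)) *\<^sub>C c j b *\<^sub>C T ((w i)(j := unit_vec b))
        = (\<Prod>l\<in>insert j J. c l ((i(j := b)) l)) *\<^sub>C
          T (\<lambda>l. if l \<in> insert j J then unit_vec ((i(j := b)) l) else x l)"
        using insert.hyps by (simp add: scaleC_scaleC mult.commute)
    qed
    finally show ?case unfolding sum_PiE_insert[OF insert.hyps(2)] .
  qed
qed

lemma T_expand:
  "T (restrict (\<lambda>j. truncate n (c j)) {..<m})
    = (\<Sum>i\<in>PiE {..<m} (\<lambda>_. {..<n}). (\<Prod>j<m. c j (i j)) *\<^sub>C coefficient m T i)"
proof -
  have "(\<lambda>j. if j \<in> {..<m} then y j else restrict (\<lambda>_ _. 0) {..<m} j) = restrict y {..<m}"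
    for y :: "nat \<Rightarrow> nat \<Rightarrow> complex" by auto
  then show ?thesis
    using T_expand_on[OF subset_refl zero_in_lp_prod, of n c] by (simp only: coefficient_def)
qed

text \<open>Continuity at the origin bounds \<open>T\<close> on a small box, and homogeneity carries the bound to the unit box.\<close>

lemma bdd_above_T:
  assumes "continuous_map_lp m p T"
  shows "bdd_above ((\<lambda>x. norm (T x)) ` {x \<in> lp_prod m p. \<forall>j<m. lp_norm (p j) (x j) < 1})"
proof -
  define z :: "nat \<Rightarrow> nat \<Rightarrow> complex" where "z = restrict (\<lambda>_ _. 0) {..<m}"
  have z: "z \<in> lp_prod m p" using zero_in_lp_prod by (simp add: z_def)
  obtain \<delta> where \<delta>: "\<delta> > 0" and cont: "\<And>y. y \<in> lp_prod m p \<Longrightarrow>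
      (\<forall>j<m. lp_norm (p j) (\<lambda>n. y j n - z j n) < \<delta>) \<Longrightarrow> norm (T y - T z) < 1"
    using assms z unfolding continuous_map_lp_def by (metis zero_less_one)
  show ?thesis
  proof (rule bdd_aboveI2)
    fix x assume "x \<in> {x \<in> lp_prod m p. \<forall>j<m. lp_norm (p j) (x j) < 1}"
    then have x: "x \<in> lp_prod m p" "\<And>j. j < m \<Longrightarrow> lp_norm (p j) (x j) < 1" by auto
    define y where "y = (\<lambda>j. if j \<in> {..<m} then (\<lambda>n. of_real \<delta> * x j n) else x j)"
    have y: "y \<in> lp_prod m p" unfolding y_def
      using x p by (intro lp_prod_if lp_scale lp_prod_mem) auto
    have "lp_norm (p j) (\<lambda>n. y j n - z j n) < \<delta>" if j: "j < m" for j
    proof -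
      have "lp_norm (p j) (\<lambda>n. of_real \<delta> * x j n) \<le> \<delta> * lp_norm (p j) (x j)"
        using lp_scale(2)[of "p j" "x j" "of_real \<delta>"] p lp_prod_mem[OF x(1) j] j \<delta> by simp
      also have "\<dots> < \<delta> * 1" using x(2)[OF j] \<delta> by (intro mult_strict_left_mono)
      finally show ?thesis using j by (simp add: y_def z_def)
    qed
    then have "norm (T y - T z) < 1" using cont[OF y] by blast
    then have "norm (T y) \<le> 1 + norm (T z)" using norm_triangle_ineq2[of "T y" "T z"] by linarith
    moreover have "T y = (of_real \<delta>) ^ m *\<^sub>C T x"
      using T_scale_all[OF subset_refl x(1), of "\<lambda>_. of_real \<delta>"] by (simp add: y_def)
    ultimately show "norm (T x) \<le> (1 + norm (T z)) / \<delta> ^ m"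
      using \<delta> by (simp add: norm_scaleC norm_power field_simps)
  qed
qed

lemma multilinear_norm_nonneg:
  assumes "continuous_map_lp m p T"
  shows "0 \<le> multilinear_norm m p T"
proof -
  have "norm (T (restrict (\<lambda>_ _. 0) {..<m})) \<le> multilinear_norm m p T"
    unfolding multilinear_norm_def using p
    by (intro cSUP_upper bdd_above_T[OF assms] CollectI conjI zero_in_lp_prod) (auto simp: lp_norm_zero)
  then show ?thesis using norm_ge_zero order_trans by blast
qed

lemma norm_T_le_strict:
  assumes cont: "continuous_map_lp m p T" and x: "x \<in> lp_prod m p"
    and t: "\<And>j. j < m \<Longrightarrow> 0 < t j" "\<And>j. j < m \<Longrightarrow> lp_norm (p j) (x j) < t j"
  shows "norm (T x) \<le> multilinear_norm m p T * (\<Prod>j<m. t j)"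
proof -
  define y where "y = (\<lambda>j. if j \<in> {..<m} then (\<lambda>n. of_real (1 / t j) * x j n) else x j)"
  have y: "y \<in> lp_prod m p" unfolding y_def
    using x p by (intro lp_prod_if lp_scale lp_prod_mem) auto
  have "lp_norm (p j) (y j) < 1" if j: "j < m" for j
  proof -
    have "lp_norm (p j) (y j) \<le> 1 / t j * lp_norm (p j) (x j)"
      using lp_scale(2)[of "p j" "x j" "of_real (1 / t j)"] p lp_prod_mem[OF x j] j t(1)[OF j]
      by (simp add: y_def norm_divide)
    also have "\<dots> < 1" using t[OF j] by (simp add: field_simps)
    finally show ?thesis .
  qed
  then have "norm (T y) \<le> multilinear_norm m p T"
    unfolding multilinear_norm_def using y by (intro cSUP_upper bdd_above_T[OF cont]) auto
  moreover have "T y = (\<Prod>j<m. of_real (1 / t j)) *\<^sub>C T x"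
    using T_scale_all[OF subset_refl x, of "\<lambda>j. of_real (1 / t j)"] by (simp add: y_def)
  moreover have "cmod (\<Prod>j<m. of_real (1 / t j)) = 1 / (\<Prod>j<m. t j)"
    using t(1) by (simp add: prod_norm[symmetric] norm_divide prod_dividef less_imp_le)
  moreover have "(\<Prod>j<m. t j) > 0" using t(1) by (intro prod_pos) auto
  ultimately show ?thesis by (simp add: norm_scaleC field_simps)
qed

text \<open>The norm of \<open>T\<close> is a supremum over open balls, so rescaling a point needs radii that are positive and
  strictly larger than its norms; the case of equality follows by letting the radii decrease.\<close>

lemma norm_T_le:
  assumes cont: "continuous_map_lp m p T" and x: "x \<in> lp_prod m p"
    and t: "\<And>j. j < m \<Longrightarrow> 0 \<le> t j" "\<And>j. j < m \<Longrightarrow> lp_norm (p j) (x j) \<le> t j"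
  shows "norm (T x) \<le> multilinear_norm m p T * (\<Prod>j<m. t j)"
proof -
  have "((\<lambda>\<delta>. multilinear_norm m p T * (\<Prod>j<m. t j + \<delta>)) \<longlongrightarrow> multilinear_norm m p T * (\<Prod>j<m. t j + 0)) (at_right 0)"
    by (intro tendsto_intros)
  moreover have "\<forall>\<^sub>F \<delta> in at_right 0. norm (T x) \<le> multilinear_norm m p T * (\<Prod>j<m. t j + \<delta>)"
    using eventually_at_right_less[of "0::real"]
  proof eventually_elim
    case (elim \<delta>)
    then show ?case using t by (intro norm_T_le_strict[OF cont x]) (force intro: add_nonneg_pos)+
  qed
  ultimately show ?thesis
    using tendsto_lowerbound[where F = "at_right (0::real)"] by fastforce
qed

lemma norm_expansion_le:
  assumes cont: "continuous_map_lp m p T"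
    and t: "\<And>j. j < m \<Longrightarrow> 0 \<le> t j" "\<And>j. j < m \<Longrightarrow> lp_norm (p j) (truncate n (c j)) \<le> t j"
  shows "norm (\<Sum>i\<in>PiE {..<m} (\<lambda>_. {..<n}). (\<Prod>j<m. c j (i j)) *\<^sub>C coefficient m T i)
    \<le> multilinear_norm m p T * (\<Prod>j<m. t j)"
  unfolding T_expand[symmetric]
  using t by (intro norm_T_le[OF cont]) (auto simp: lp_prod_def truncate_in_lp)

end

section \<open>Summability of the coefficients\<close>

text \<open>The case \<open>lam \<le> q < \<infinity>\<close> for finitely many indices. A weight \<open>y j\<close> in \<open>remove_weights\<close> stands for
  \<open>x j powr q\<close>, where \<open>x j\<close> is the diagonal of an operator from bounded sequences into the space with
  exponent \<open>p j\<close>; coordinates with \<open>p j = \<infinity>\<close> carry the weight \<open>1\<close>.\<close>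

lemma finite_section_sum_le:
  fixes v :: "'x::complex_banach \<Rightarrow> 'y::complex_banach" and q r lam mu :: real
  assumes m: "1 \<le> m" and p: "\<forall>j<m. 1 \<le> p j"
    and T: "multilinear_map m p T" "continuous_map_lp m p T"
    and cot: "rad_cotype TYPE('y) q D n" and D: "0 \<le> D"
    and v: "bounded_clinear v" "summing_with r C v" and C: "0 \<le> C"
    and r: "1 \<le> r" "r \<le> q" and lam: "0 < lam" "lam \<le> q"
    and lam_eq: "1 / lam = 1 / r - (\<Sum>j<m. real_of_ereal (1 / p j))"
    and mu_eq: "1 / mu = 1 / (real m * lam) + (real m - 1) / real m * (1 / q)"
  shows "(\<Sum>i\<in>PiE {..<m} (\<lambda>_. {..<n}). norm (v (coefficient m T i)) powr mu)
    \<le> (C * D ^ (m - 1) * multilinear_norm m p T) powr mu"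
proof -
  define F where "F = {j \<in> {..<m}. p j \<noteq> \<infinity>}"
  define P where "P j = real_of_ereal (p j)" for j
  define N where "N = multilinear_norm m p T"
  define w where "w i = norm (v (coefficient m T i)) powr q" for i
  define K where "K = (C * D ^ (m - 1) * N) powr r"
  let ?I = "PiE {..<m} (\<lambda>_. {..<n})"
  have N0: "0 \<le> N" unfolding N_def by (rule multilinear_norm_nonneg[OF p T])
  have CN: "0 \<le> C * D ^ (m - 1) * N" using C D N0 by simp
  have F: "finite F" "F \<subseteq> {..<m}" by (auto simp: F_def)
  have P: "1 \<le> P j" "real_of_ereal (1 / p j) = 1 / P j" if "j \<in> F" for j
  proof -
    have "1 \<le> p j" "p j \<noteq> \<infinity>" using that p by (auto simp: F_def)
    then show "1 \<le> P j" "real_of_ereal (1 / p j) = 1 / P j"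
      by (cases "p j"; simp add: P_def one_ereal_def)+
  qed
  have q: "1 \<le> q" using r by simp
  have "(\<Sum>j<m. real_of_ereal (1 / p j)) = (\<Sum>j\<in>F. real_of_ereal (1 / p j))"
    using F by (intro sum.mono_neutral_right) (auto simp: F_def)
  then have lam_F: "1 / lam = 1 / r - (\<Sum>j\<in>F. 1 / P j)"
    using lam_eq P by simp
  have step: "(\<Sum>a<n. (\<Sum>i\<in>{i\<in>?I. i k = a}. w i) powr (lam / q)) \<le> K powr ((lam / q) / (r / q))"
    if k: "k < m" for k
  proof (rule remove_weights[where \<pi> = "\<lambda>k i. i k" and P = "\<lambda>j. P j / q" and J = F and M = "{..<m}"])
    have "1 / (lam / q) = q * (1 / lam)" by simp
    also have "\<dots> = 1 / (r / q) - (\<Sum>j\<in>F. 1 / (P j / q))"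
      unfolding lam_F by (simp add: right_diff_distrib sum_distrib_left)
    finally show "1 / (lam / q) = 1 / (r / q) - (\<Sum>j\<in>F. 1 / (P j / q))" .
    show "0 < P j / q" if "j \<in> F" for j using P(1)[OF that] q by simp
    show "(\<Sum>a<n. (\<Sum>i\<in>{i\<in>?I. i k = a}. w i * (\<Prod>j\<in>F. y j (i j))) powr (r / q))
        \<le> K * (\<Prod>j\<in>F. (\<Sum>b<n. y j b powr (P j / q)) powr (r / q / (P j / q)))"
      if k: "k \<in> {..<m}" and y: "\<And>j b. 0 \<le> y j b" for k and y :: "nat \<Rightarrow> nat \<Rightarrow> real"
    proof -
      define x where "x j b = (if j \<in> F then y j b powr (1 / q) else 1)" for j b
      define t where "t j = (if j \<in> F then (\<Sum>b<n. y j b powr (P j / q)) powr (1 / P j) else 1)" for j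
      define a where "a i = complex_of_real (\<Prod>j<m. x j (i j)) *\<^sub>C coefficient m T i" for i
      have x0: "0 \<le> x j b" for j b by (simp add: x_def)
      have prodF: "(\<Prod>j<m. if j \<in> F then g j else 1) = (\<Prod>j\<in>F. g j)" for g :: "nat \<Rightarrow> real"
        using F by (intro prod.mono_neutral_cong_right) auto
      have "(\<Sum>a<n. (\<Sum>i\<in>{i\<in>?I. i k = a}. w i * (\<Prod>j\<in>F. y j (i j))) powr (r / q))
          = (\<Sum>b<n. (\<Sum>i\<in>{i\<in>?I. i k = b}. norm (v (a i)) powr q) powr (r / q))"
      proof (intro sum.cong refl arg_cong2[where f = "(powr)"])
        fix i
        have "(\<Prod>j<m. x j (i j)) powr q = (\<Prod>j\<in>F. y j (i j))"
          unfolding prod_powr_distrib prodF[symmetric] using q y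
          by (intro prod.cong) (auto simp: x_def powr_powr)
        moreover have "norm (v (a i)) = (\<Prod>j<m. x j (i j)) * norm (v (coefficient m T i))"
          using v(1) x0 unfolding a_def bounded_clinear_def
          by (simp add: norm_scaleC abs_of_nonneg prod_nonneg del: of_real_prod)
        ultimately show "w i * (\<Prod>j\<in>F. y j (i j)) = norm (v (a i)) powr q"
          using x0 by (simp add: w_def powr_mult prod_nonneg)
      qed
      also have "\<dots> \<le> (C * D ^ (card {..<m} - 1) * (N * (\<Prod>j<m. t j))) powr r"
      proof (rule mixed_sum_le[OF cot D v C r _ k])
        show "0 \<le> N * (\<Prod>j<m. t j)" using N0 by (simp add: t_def prod_nonneg)
        fix c :: "nat \<Rightarrow> nat \<Rightarrow> complex" assume c: "\<And>j b. cmod (c j b) = 1"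
        define d where "d j b = c j b * of_real (x j b)" for j b
        have d: "cmod (d j b) = x j b" for j b using c x0 by (simp add: d_def norm_mult)
        have "(\<Sum>i\<in>?I. (\<Prod>j<m. c j (i j)) *\<^sub>C a i) = (\<Sum>i\<in>?I. (\<Prod>j<m. d j (i j)) *\<^sub>C coefficient m T i)"
          by (simp add: a_def d_def scaleC_scaleC prod.distrib)
        also have "norm \<dots> \<le> N * (\<Prod>j<m. t j)"
          unfolding N_def
        proof (rule norm_expansion_le[OF p T])
          show "0 \<le> t j" for j by (simp add: t_def)
          show "lp_norm (p j) (truncate n (d j)) \<le> t j" if "j < m" for j
          proof (cases "j \<in> F")
            case True
            then show ?thesis
              by (simp add: F_def lp_norm_truncate d P_def[symmetric] t_def x_def powr_powr)
          next
            case False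
            then have "p j = \<infinity>" using that by (simp add: F_def)
            then show ?thesis using False d
              by (simp add: t_def x_def lp_norm_truncate_infinity)
          qed
        qed
        finally show "norm (\<Sum>i\<in>?I. (\<Prod>j<m. c j (i j)) *\<^sub>C a i) \<le> N * (\<Prod>j<m. t j)" .
      qed simp
      also have "\<dots> = K * (\<Prod>j<m. t j) powr r"
        using CN by (simp add: K_def powr_mult[symmetric] t_def prod_nonneg mult.assoc)
      also have "(\<Prod>j<m. t j) powr r = (\<Prod>j\<in>F. (\<Sum>b<n. y j b powr (P j / q)) powr (r / q / (P j / q)))"
        unfolding prod_powr_distrib prodF[symmetric] using q
        by (intro prod.cong) (auto simp: t_def powr_powr)
      finally show ?thesis .
    qed
  qed (use F k q r lam in \<open>auto simp: w_def K_def intro!: finite_PiE\<close>)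
  have mu: "0 < mu"
  proof -
    have "0 < 1 / mu" unfolding mu_eq using m lam q by (intro add_pos_nonneg) auto
    then show ?thesis by simp
  qed
  have "(\<Sum>i\<in>?I. w i powr (mu / q)) \<le> (K powr (lam / r)) powr ((mu / q) / (lam / q))"
  proof (rule blei)
    have "1 / (mu / q) = q * (1 / mu)" by simp
    also have "\<dots> = 1 / (real m * (lam / q)) + (real m - 1) / real m"
      unfolding mu_eq using q by (simp add: distrib_left)
    finally show "1 / (mu / q) = 1 / (real (card {..<m}) * (lam / q)) + (real (card {..<m}) - 1) / real (card {..<m})"
      by simp
    show "(\<Sum>a<n. (\<Sum>i\<in>{i\<in>?I. i k = a}. w i) powr (lam / q)) \<le> K powr (lam / r)" if "k \<in> {..<m}" for k
      using step[of k] that q by simp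
  qed (use m lam q in \<open>auto simp: w_def lessThan_empty_iff\<close>)
  also have "\<dots> = (C * D ^ (m - 1) * N) powr mu"
    using lam r q by (simp add: K_def powr_powr)
  also have "(\<Sum>i\<in>?I. w i powr (mu / q)) = (\<Sum>i\<in>?I. norm (v (coefficient m T i)) powr mu)"
    using q by (simp add: w_def powr_powr)
  finally show ?thesis by (simp add: N_def)
qed

lemma ls_sum_leI:
  assumes box: "\<And>n. 0 < n \<Longrightarrow> (\<Sum>i\<in>PiE {..<m} (\<lambda>_. {..<n}). norm (b i) powr s) \<le> K powr s"
    and s: "0 < s" and K: "0 \<le> K"
  shows "ls_sum_le (multi_indices m) s b K"
proof -
  have le: "(\<Sum>i\<in>A. norm (b i) powr s) \<le> K powr s" if A: "finite A" "A \<subseteq> multi_indices m" for A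
  proof -
    define n where "n = Suc (Max (insert 0 ((\<lambda>(i, j). i j) ` (A \<times> {..<m}))))"
    have "i j < n" if "i \<in> A" "j < m" for i j
      unfolding n_def less_Suc_eq_le using that A(1)
      by (intro Max_ge) (auto intro!: image_eqI[of _ _ "(i, j)"])
    then have sub: "A \<subseteq> PiE {..<m} (\<lambda>_. {..<n})"
      using A(2) unfolding multi_indices_def PiE_iff subset_iff by auto
    have "(\<Sum>i\<in>A. norm (b i) powr s) \<le> (\<Sum>i\<in>PiE {..<m} (\<lambda>_. {..<n}). norm (b i) powr s)"
      using sub by (intro sum_mono2 finite_PiE) auto
    also have "\<dots> \<le> K powr s" by (rule box) (simp add: n_def)
    finally show ?thesis .
  qed
  have sum: "(\<lambda>i. norm (b i) powr s) summable_on multi_indices m"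
    by (rule nonneg_bdd_above_summable_on) (auto intro!: bdd_aboveI[of _ "K powr s"] le)
  then have "(\<Sum>\<^sub>\<infinity>i\<in>multi_indices m. norm (b i) powr s) \<le> K powr s"
    by (rule infsum_le_finite_sums) (rule le)
  then have "(\<Sum>\<^sub>\<infinity>i\<in>multi_indices m. norm (b i) powr s) powr (1 / s) \<le> (K powr s) powr (1 / s)"
    using s by (intro powr_mono2 infsum_nonneg) auto
  then show ?thesis using sum s K by (simp add: ls_sum_le_def powr_powr)
qed

theorem theorem1p2:
  fixes m :: nat
    and q :: ereal
    and r lam mu :: real
    and p :: "nat \<Rightarrow> ereal"
    and v :: "'x::complex_banach \<Rightarrow> 'y::complex_banach"
  assumes "1 \<le> m"
    and "has_cotype TYPE('y) q"
    and "summing_operator r 1 v"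
    and "1 \<le> r" and "ereal r \<le> q"
    and "\<forall>j<m. 1 \<le> p j"
    and "(\<Sum>j<m. real_of_ereal (1 / p j)) < 1 / r"
    and "1 / lam = 1 / r - (\<Sum>j<m. real_of_ereal (1 / p j))"
    and "1 / mu = 1 / (real m * lam) + (real m - 1) / real m * real_of_ereal (1 / q)"
  shows "\<exists>C>0. \<forall>T :: (nat \<Rightarrow> nat \<Rightarrow> complex) \<Rightarrow> 'x.
    multilinear_map m p T \<and> continuous_map_lp m p T \<longrightarrow>
      (q \<le> ereal lam \<longrightarrow>
        ls_sum_le (multi_indices m) lam (\<lambda>i. v (coefficient m T i)) (C * multilinear_norm m p T)) \<and>
      (ereal lam < q \<longrightarrow>
        ls_sum_le (multi_indices m) mu (\<lambda>i. v (coefficient m T i)) (C * multilinear_norm m p T))"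
proof -
  note m = assms(1) and p = assms(6) and lam_eq = assms(8) and mu_eq = assms(9)
  obtain c where v: "bounded_clinear v" and c: "c > 0" "summing_with r c v"
    using summing_operator_with[OF assms(3)] by auto
  have lam: "0 < lam"
  proof -
    have "0 < 1 / lam" using assms(7) lam_eq by simp
    then show ?thesis by simp
  qed
  have q0: "0 \<le> real_of_ereal (1 / q)" using assms(4,5) by (cases q) (auto simp: one_ereal_def)
  have mu: "0 < mu"
  proof -
    have "0 < 1 / mu" unfolding mu_eq using m lam q0 by (intro add_pos_nonneg) auto
    then show ?thesis by simp
  qed
  show ?thesis
  proof (cases "q = \<infinity>")
    case False
    then obtain q' where q: "q = ereal q'" using assms(5) by (cases q) auto
    \<comment> \<open>The space also has cotype \<open>s\<close>, and for \<open>q' \<le> lam\<close> the exponent belonging to \<open>s\<close> is \<open>lam\<close> itself.\<close>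
    define s where "s = max q' lam"
    define \<mu> where "\<mu> = (if q \<le> ereal lam then lam else mu)"
    obtain D where D: "D > 0" "\<And>n. rad_cotype TYPE('y) s D n"
      using has_cotype_finite[OF assms(2), of s] by (auto simp: q s_def)
    have exps: "r \<le> s" "lam \<le> s" using assms(5) by (auto simp: q s_def)
    have \<mu>_eq: "1 / \<mu> = 1 / (real m * lam) + (real m - 1) / real m * (1 / s)"
      using mu_eq m lam assms(4) by (auto simp: \<mu>_def s_def q one_ereal_def field_simps)
    have "ls_sum_le (multi_indices m) \<mu> (\<lambda>i. v (coefficient m T i)) (c * D ^ (m - 1) * multilinear_norm m p T)"
      if T: "multilinear_map m p T" "continuous_map_lp m p T" for T :: "(nat \<Rightarrow> nat \<Rightarrow> complex) \<Rightarrow> 'x"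
    proof (rule ls_sum_leI)
      show "(\<Sum>i\<in>PiE {..<m} (\<lambda>_. {..<n}). norm (v (coefficient m T i)) powr \<mu>)
          \<le> (c * D ^ (m - 1) * multilinear_norm m p T) powr \<mu>" for n
        using finite_section_sum_le[OF m p T D(2) _ v c(2) _ assms(4) exps(1) lam exps(2) lam_eq \<mu>_eq] c(1) D(1)
        by simp
      show "0 < \<mu>" using lam mu by (simp add: \<mu>_def)
      show "0 \<le> c * D ^ (m - 1) * multilinear_norm m p T"
        using c(1) D(1) multilinear_norm_nonneg[OF p T] by simp
    qed
    then show ?thesis
      using c(1) D(1) by (intro exI[of _ "c * D ^ (m - 1)"]) (auto simp: \<mu>_def not_less[symmetric])
  next
    case True
    obtain D where D: "D > 0"
      and cot: "\<And>n s. 0 < s \<Longrightarrow> rad_cotype TYPE('y) s (real n powr (1 / s) * D) n"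
      using has_cotype_infinity assms(2) True by blast
    have "ls_sum_le (multi_indices m) mu (\<lambda>i. v (coefficient m T i)) (c * D ^ (m - 1) * multilinear_norm m p T)"
      if T: "multilinear_map m p T" "continuous_map_lp m p T" for T :: "(nat \<Rightarrow> nat \<Rightarrow> complex) \<Rightarrow> 'x"
    proof (rule ls_sum_leI)
      fix n :: nat assume n: "0 < n"
      define N where "N = multilinear_norm m p T"
      have N: "0 \<le> N" unfolding N_def by (rule multilinear_norm_nonneg[OF p T])
      \<comment> \<open>the exponent and the bound that belong to the finite cotype \<open>s\<close>\<close>
      define \<mu> where "\<mu> s = 1 / (1 / (real m * lam) + (real m - 1) / real m * (1 / s))" for s
      define B where "B s = c * (real n powr (1 / s) * D) ^ (m - 1) * N" for s
      have inv: "((\<lambda>s::real. 1 / s) \<longlongrightarrow> 0) at_top"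
        using tendsto_inverse_0_at_top[OF filterlim_ident] by (simp add: inverse_eq_divide)
      have "(\<mu> \<longlongrightarrow> 1 / (1 / (real m * lam) + (real m - 1) / real m * 0)) at_top"
        unfolding \<mu>_def using m lam by (intro tendsto_intros inv) auto
      then have \<mu>: "(\<mu> \<longlongrightarrow> mu) at_top" using mu_eq True by (simp add: field_simps)
      have "(B \<longlongrightarrow> c * (real n powr 0 * D) ^ (m - 1) * N) at_top"
        unfolding B_def using n by (intro tendsto_intros inv) auto
      then have B: "(B \<longlongrightarrow> c * D ^ (m - 1) * N) at_top" using n by simp
      have "\<forall>\<^sub>F s in at_top. (\<Sum>i\<in>PiE {..<m} (\<lambda>_. {..<n}). norm (v (coefficient m T i)) powr \<mu> s) \<le> B s powr \<mu> s"
        using eventually_ge_at_top[of "max r lam"]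
      proof eventually_elim
        case (elim s)
        then have s: "0 < s" "r \<le> s" "lam \<le> s" using lam by auto
        have "1 / \<mu> s = 1 / (real m * lam) + (real m - 1) / real m * (1 / s)" by (simp add: \<mu>_def)
        then show ?case
          using finite_section_sum_le[OF m p T cot[OF s(1)] _ v c(2) _ assms(4) s(2) lam s(3) lam_eq] c(1) D
          by (simp add: B_def N_def)
      qed
      moreover have "((\<lambda>s. \<Sum>i\<in>PiE {..<m} (\<lambda>_. {..<n}). norm (v (coefficient m T i)) powr \<mu> s)
          \<longlongrightarrow> (\<Sum>i\<in>PiE {..<m} (\<lambda>_. {..<n}). norm (v (coefficient m T i)) powr mu)) at_top"
        using mu by (intro tendsto_sum tendsto_powr' \<mu> tendsto_const) auto
      moreover have "((\<lambda>s. B s powr \<mu> s) \<longlongrightarrow> (c * D ^ (m - 1) * N) powr mu) at_top"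
        using mu c(1) D N by (intro tendsto_powr' \<mu> B) (auto simp: B_def)
      ultimately show "(\<Sum>i\<in>PiE {..<m} (\<lambda>_. {..<n}). norm (v (coefficient m T i)) powr mu)
          \<le> (c * D ^ (m - 1) * multilinear_norm m p T) powr mu"
        unfolding N_def[symmetric] by (intro tendsto_le[OF trivial_limit_at_top_linorder])
    next
      show "0 < mu" by (rule mu)
      show "0 \<le> c * D ^ (m - 1) * multilinear_norm m p T"
        using c(1) D multilinear_norm_nonneg[OF p T] by simp
    qed
    then show ?thesis
      using c(1) D True by (intro exI[of _ "c * D ^ (m - 1)"]) auto
  qed
qed

end
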